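(* Let $G$ be a finite group with $c(G)\leqslant 31$. Then $G$ is solvable.
   Context: For a finite group $G$, $c(G)$ denotes the number of all cyclic subgroups of $G$ (including the trivial subgroup). *)

theory Defs
  imports "HOL-Algebra.Algebra"
begin

definition cyclic_subgroups :: "('a, 'b) monoid_scheme \<Rightarrow> 'a set set"
  where "cyclic_subgroups G = {H. subgroup H G \<and> cyclic_group (G\<lparr>carrier := H\<rparr>)}"

definition num_cyclic_subgroups :: "('a, 'b) monoid_scheme \<Rightarrow> nat"
  where "num_cyclic_subgroups G = card (cyclic_subgroups G)"

text \<open>Cyclicity is that of the subgroup as a group in its own right; for a group \<open>G\<close> this gives
  exactly the subgroups generated by a single element, the trivial subgroup among them.\<close>

lemma (in group) cyclic_subgroups_eq_generate:
  "cyclic_subgroups G = (\<lambda>x. generate G {x}) ` carrier G"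
proof
  show "cyclic_subgroups G \<subseteq> (\<lambda>x. generate G {x}) ` carrier G"
  proof
    fix H assume "H \<in> cyclic_subgroups G"
    then have H: "subgroup H G" and "cyclic_group (G\<lparr>carrier := H\<rparr>)"
      by (auto simp: cyclic_subgroups_def)
    then obtain x where x: "x \<in> H"
        and "subgroup_generated (G\<lparr>carrier := H\<rparr>) {x} = G\<lparr>carrier := H\<rparr>"
      by (auto simp: cyclic_group_def)
    then have "carrier (subgroup_generated (G\<lparr>carrier := H\<rparr>) {x}) = H" by simp
    then have "generate (G\<lparr>carrier := H\<rparr>) {x} = H"
      using x by (simp add: carrier_subgroup_generated)
    then have "H = generate G {x}"
      using generate_consistent[OF _ H] x by simp
    then show "H \<in> (\<lambda>x. generate G {x}) ` carrier G"
      using x subgroup.subset[OF H] by auto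
  qed
next
  show "(\<lambda>x. generate G {x}) ` carrier G \<subseteq> cyclic_subgroups G"
  proof
    fix H assume "H \<in> (\<lambda>x. generate G {x}) ` carrier G"
    then obtain x where x: "x \<in> carrier G" and H: "H = generate G {x}" by auto
    then have "subgroup_generated G {x} = G\<lparr>carrier := H\<rparr>"
      by (simp add: subgroup_generated_def)
    then show "H \<in> cyclic_subgroups G"
      using cyclic_group_generated[of x] generate_is_subgroup[of "{x}"] x H
      by (simp add: cyclic_subgroups_def)
  qed
qed

end

theory Submission
  imports Defs "HOL-Library.Multiset" "HOL-Number_Theory.Cong" "HOL-Number_Theory.Totient"
begin

text \<open>Passing to a subgroup or to a quotient does not increase the number of cyclic subgroups, and a
  non-solvable finite group has a nonabelian simple quotient of a perfect subgroup. So it suffices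
  that a nonabelian simple group \<open>G\<close> has at least 32 cyclic subgroups. To a conjugacy class of
  nontrivial cyclic subgroups attach the pair \<open>(m, s)\<close> of the order of its members and its size.
  If the sizes add up to at most 30, then these pairs are contradictory: \<open>|G|\<close> is one plus the sum
  of the \<open>s \<cdot> \<phi>(m)\<close>; simplicity gives \<open>|G| dvd s!\<close>, whence every \<open>s\<close> is at least the largest
  prime divisor of \<open>|G|\<close>; and Sylow-type congruences leave only a few numerical cases.
  The group \<open>A\<^sub>5\<close> is just excluded: there the sizes are 15, 10 and 6.\<close>

hide_const (open) Divisibility.prime

section \<open>Numerical constraints on the conjugacy classes of cyclic subgroups\<close>

text \<open>The bound 30 is 31 less the trivial subgroup; the classes of \<open>A_5\<close> total
  31. Let \<open>q\<close> be the largest prime divisor of the order. The subgroups of order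
  \<open>q\<close> number 1 modulo \<open>q\<close>, so one of their classes has size prime to
  \<open>q\<close>, hence above \<open>q\<close>. A prime factor of that size is a second prime
  divisor of the order and brings another class of size at least \<open>q\<close>. So 2q + 1 is at
  most 30, and \<open>q\<close> is one of 3, 5, 7, 11, 13. The obstacle is that the congruence for
  order \<open>p\<close> concerns the sum over all classes of that order, whose number is unknown.
  Two devices isolate one class: the rest of the budget is too small for a further class, or
  \<open>p\<close> divides the order only once, and then the congruence holds for each class
  separately. What remains is settled by the factorization of the sizes, which divide the order, and
  by classes of order 2p that centralizers of involutions force.\<close>

lemma dvd_sum_mset:
  fixes f :: "'a \<Rightarrow> 'b::comm_semiring_1"
  shows "(\<And>x. x \<in># A \<Longrightarrow> d dvd f x) \<Longrightarrow> d dvd (\<Sum>x\<in>#A. f x)"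
  by (induction A) auto

lemma mem_upt_range: "a \<le> s \<Longrightarrow> s < b \<Longrightarrow> s \<in> set [a..<b]"
  by simp

text \<open>Isolates the arithmetic, so that the case analysis mentions no group. \<open>M\<close>
  is a multiset since different classes may share order and size. \<open>mult_dvd\<close> reflects
  that a cyclic subgroup lies in its normalizer, whose index is the class size;
  \<open>divisor_class\<close> that a subgroup of a cyclic group is characteristic in it.
  \<open>prime_cong\<close> sums over all classes of order \<open>p\<close>, whereas
  \<open>sylow_prime_cong\<close> speaks of each one.\<close>

locale cyclic_class_data =
  fixes N :: nat and M :: "(nat \<times> nat) multiset"
  assumes N_gt_1: "N > 1"
    and total: "(\<Sum>x\<in>#M. snd x) \<le> 30"
    and count: "N = 1 + (\<Sum>x\<in>#M. snd x * totient (fst x))"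
    and mult_dvd: "(m, s) \<in># M \<Longrightarrow> m * s dvd N"
    and dvd_fact: "(m, s) \<in># M \<Longrightarrow> N dvd fact s"
    and order_ge_2: "(m, s) \<in># M \<Longrightarrow> 2 \<le> m"
    and size_ge_2: "(m, s) \<in># M \<Longrightarrow> 2 \<le> s"
    and divisor_class: "(m, s) \<in># M \<Longrightarrow> d dvd m \<Longrightarrow> 2 \<le> d \<Longrightarrow> \<exists>s'. (d, s') \<in># M \<and> s' dvd s"
    and prime_cong: "prime p \<Longrightarrow> p dvd N \<Longrightarrow> [(\<Sum>x\<in>#M. if fst x = p then snd x else 0) = 1] (mod p)"
    and sylow_prime_cong: "prime p \<Longrightarrow> \<not> p\<^sup>2 dvd N \<Longrightarrow> (p, s) \<in># M \<Longrightarrow> [s = 1] (mod p)"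
    and involution_class: "(2, s) \<in># M \<Longrightarrow> prime p \<Longrightarrow> p \<noteq> 2 \<Longrightarrow> p * s dvd N \<Longrightarrow> \<exists>s'. (2 * p, s') \<in># M"
    and sylow_less: "prime p \<Longrightarrow> p ^ a dvd N \<Longrightarrow> p ^ a < N \<Longrightarrow> 1 < p ^ a \<Longrightarrow>
       p ^ a < 1 + (\<Sum>x\<in>#M. if fst x dvd p ^ a then snd x * totient (fst x) else 0)"
begin

section \<open>Divisibility of class sizes and the budget for further classes\<close>

lemma size_dvd: "(m, s) \<in># M \<Longrightarrow> s dvd N"
  using mult_dvd dvd_mult_right by blast

lemma order_dvd: "(m, s) \<in># M \<Longrightarrow> m dvd N"
  using mult_dvd dvd_mult_left by blast

lemma prime_le_size: "(m, s) \<in># M \<Longrightarrow> prime p \<Longrightarrow> p dvd N \<Longrightarrow> p \<le> s"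
  by (meson dvd_fact dvd_trans prime_dvd_fact_iff)

text \<open>If \<open>p\<close> divided the size of every class of order \<open>p\<close>, these
  sizes would add up to 0 rather than 1 modulo \<open>p\<close>.\<close>

lemma prime_class:
  assumes "prime p" "p dvd N"
  obtains s where "(p, s) \<in># M" "\<not> p dvd s"
proof (rule ccontr)
  assume "\<not> thesis"
  then have "p dvd (if fst x = p then snd x else 0)" if "x \<in># M" for x
    using that \<open>\<not> thesis\<close> \<open>\<And>s. (p, s) \<in># M \<Longrightarrow> \<not> p dvd s \<Longrightarrow> thesis\<close> by (cases x) auto
  then have "p dvd (\<Sum>x\<in>#M. if fst x = p then snd x else 0)"
    by (rule dvd_sum_mset)
  then have "[0 = 1] (mod p)"
    using prime_cong[OF assms] by (metis cong_0_iff cong_sym cong_trans)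
  then show False
    using assms(1) by (simp add: cong_def)
qed

lemma pair_decomposition:
  assumes "(a, s) \<in># M" "(b, t) \<in># M" "a \<noteq> b"
  obtains M' where "M = add_mset (a, s) (add_mset (b, t) M')"
proof -
  obtain M1 where M1: "M = add_mset (a, s) M1"
    using assms(1) multi_member_split by metis
  then have "(b, t) \<in># M1" using assms by auto
  then obtain M2 where "M1 = add_mset (b, t) M2"
    using multi_member_split by metis
  then show ?thesis using M1 that by blast
qed

lemma triple_decomposition:
  assumes "(a, s) \<in># M" "(b, t) \<in># M" "(c, u) \<in># M" "a \<noteq> b" "a \<noteq> c" "b \<noteq> c"
  obtains M' where "M = add_mset (a, s) (add_mset (b, t) (add_mset (c, u) M'))"
proof -
  obtain M1 where M1: "M = add_mset (a, s) (add_mset (b, t) M1)"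
    using pair_decomposition[of a s b t] assms by metis
  then have "(c, u) \<in># M1" using assms by auto
  then obtain M2 where "M1 = add_mset (c, u) M2"
    using multi_member_split by metis
  then show ?thesis using M1 that by blast
qed

text \<open>The budget argument: \<open>A\<close> holds the classes already exhibited, and what they
  leave to \<open>B\<close> does not pay for even one class of the minimal size
  \<open>b\<close>.\<close>

lemma rest_empty:
  assumes "M = A + B" "\<And>m s. (m, s) \<in># M \<Longrightarrow> b \<le> s" "(\<Sum>x\<in>#B. snd x) < b"
  shows "B = {#}"
proof (rule ccontr)
  assume "B \<noteq> {#}"
  then obtain x where x: "x \<in># B" by blast
  then obtain B' where "B = add_mset x B'" using multi_member_split by metis
  moreover have "b \<le> snd x" using x assms(1) assms(2)[of "fst x" "snd x"] by simp
  ultimately show False using assms(3) by simp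
qed

lemma rest_one:
  assumes "M = A + B" "\<And>m s. (m, s) \<in># M \<Longrightarrow> b \<le> s" "(\<Sum>x\<in>#B. snd x) < 2 * b" "B \<noteq> {#}"
  shows "\<exists>m s. B = {#(m, s)#}"
proof -
  obtain x where x: "x \<in># B" using assms(4) by blast
  then obtain B' where B': "B = add_mset x B'" using multi_member_split by metis
  have "b \<le> snd x" using x assms(1) assms(2)[of "fst x" "snd x"] by simp
  then have "B' = {#}"
    using rest_empty[of "add_mset x A" B' b] assms(1-3) B' by simp
  then have "B = {#(fst x, snd x)#}" using B' by simp
  then show ?thesis by blast
qed

text \<open>Sizes of at least q + 1 and q leave less than \<open>q\<close>, so there are just two
  classes, of orders \<open>q\<close> and \<open>p\<close>, and no primes but these divide
  \<open>N\<close>. The congruence makes the first size q + 1, that is 12 or 14, which has two prime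
  factors other than \<open>q\<close>.\<close>

lemma no_class_data_prime_11_13:
  assumes q: "prime q" "q dvd N" "q \<in> {11, 13}"
  shows False
proof -
  obtain sq where sq: "(q, sq) \<in># M" "\<not> q dvd sq" using prime_class[OF q(1,2)] .
  have ge: "q \<le> s" if "(m, s) \<in># M" for m s using that prime_le_size q by blast
  have "sq > q" using ge[OF sq(1)] sq(2) by (cases "sq = q") auto
  have "sq \<noteq> 1" using size_ge_2[OF sq(1)] by simp
  then obtain p where p: "prime p" "p dvd sq" using prime_factor_nat by blast
  then have "p dvd N" using size_dvd sq(1) dvd_trans by blast
  then obtain sp where sp: "(p, sp) \<in># M" using prime_class p(1) by metis
  have "p \<noteq> q" using p sq by auto
  then obtain M1 where M1: "M = add_mset (q, sq) (add_mset (p, sp) M1)"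
    using pair_decomposition sq(1) sp by metis
  have b: "sq + sp + (\<Sum>x\<in>#M1. snd x) \<le> 30" using total M1 by simp
  have "M1 = {#}"
    using rest_empty[of "{#(q, sq), (p, sp)#}" M1 q] ge M1 b \<open>sq > q\<close> ge[OF sp] q(3) by auto
  then have "[sq = 1] (mod q)" using prime_cong[OF q(1,2)] M1 \<open>p \<noteq> q\<close> by simp
  then have c: "sq = q + 1"
    using q(3) b \<open>sq > q\<close> ge[OF sp]
    by (auto simp: cong_def mod_nat_eqI elim!: ) presburger+
  have keys: "r = p \<or> r = q" if "prime r" "r dvd N" for r
    using prime_class[OF that] M1 \<open>M1 = {#}\<close> by auto
  have "sq dvd N" using size_dvd sq(1) .
  then have "q = 11 \<and> 2 dvd N \<and> 3 dvd N \<or> q = 13 \<and> 2 dvd N \<and> 7 dvd N"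
    using c q(3) by (auto intro: dvd_trans[of _ 12] dvd_trans[of _ 14])
  then show False using keys[of 2] keys[of 3] keys[of 7] by auto
qed


text \<open>Once 25 is excluded, \<open>s5\<close> is 6 or 16, as 11 and 21 have prime factors above
  5. For 6 the involutions have size 15, 9 or 5. The value 15 is that of \<open>A_5\<close>; the two
  others force elements of order 10 and 6.\<close>

lemma no_max_prime_5:
  assumes q: "5 dvd N" and max: "\<And>p. prime p \<Longrightarrow> p dvd N \<Longrightarrow> p \<le> 5"
  shows False
proof -
  have P: "prime (2::nat)" "prime (3::nat)" "prime (5::nat)" "prime (7::nat)" "prime (11::nat)" "prime (13::nat)"
    by simp_all
  have not_dvd: "\<not> 7 dvd N" "\<not> 11 dvd N" "\<not> 13 dvd N"
    using max[of 7] max[of 11] max[of 13] P by auto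
  have ge: "5 \<le> s" if "(m, s) \<in># M" for m s using that prime_le_size q P by blast
  obtain s5 where s5: "(5, s5) \<in># M" "\<not> 5 dvd s5" using prime_class[OF P(3) q] .
  have "s5 > 5" using ge[OF s5(1)] s5(2) by (cases "s5 = 5") auto
  have nd: "\<not> 7 dvd s" "\<not> 11 dvd s" "\<not> 13 dvd s" if "(m, s) \<in># M" for m s
    using size_dvd[OF that] not_dvd dvd_trans by blast+
  have "s5 \<noteq> 1" using size_ge_2[OF s5(1)] by simp
  then obtain p where p: "prime p" "p dvd s5" using prime_factor_nat by blast
  then have "p dvd N" using size_dvd s5(1) dvd_trans by blast
  then obtain sp where sp: "(p, sp) \<in># M" "\<not> p dvd sp" using prime_class p(1) by metis
  have "p \<noteq> 5" using p s5 by auto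
  then obtain M1 where M1: "M = add_mset (5, s5) (add_mset (p, sp) M1)"
    using pair_decomposition s5(1) sp(1) by metis
  have b: "s5 + sp + (\<Sum>x\<in>#M1. snd x) \<le> 30" using total M1 by simp
  have not25: "\<not> 25 dvd N"
  proof
    assume d: "25 dvd N"
    \<comment> \<open>\<open>9!\<close> contains the factor 5 only once.\<close>
    have ge10: "10 \<le> s" if "(m, s) \<in># M" for m s
    proof (rule ccontr)
      assume "\<not> 10 \<le> s"
      then have "fact s dvd (fact 9 :: nat)" by (intro fact_dvd) simp
      then have "25 dvd (fact 9 :: nat)" using d dvd_fact[OF that] dvd_trans by blast
      then show False by (simp add: fact_numeral)
    qed
    have "s5 \<noteq> 10" using s5(2) by auto
    have "M1 = {#}"
      using rest_empty[of "{#(5, s5), (p, sp)#}" M1 10] ge10 M1 b ge10[OF sp(1)] ge10[OF s5(1)] \<open>s5 \<noteq> 10\<close> by auto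
    then have "[s5 = 1] (mod 5)" using prime_cong[OF P(3) q] M1 \<open>p \<noteq> 5\<close> by simp
    moreover have "10 \<le> s5" "s5 \<le> 20" using ge10[OF sp(1)] ge10[OF s5(1)] b by auto
    ultimately have "s5 = 11 \<or> s5 = 16"
      using mem_upt_range[of 10 s5 21] by (auto simp: cong_def simp del: set_upt)
    then have s5_16: "s5 = 16" using nd[OF s5(1)] by auto
    then have "even N" using size_dvd[OF s5(1)] by (auto intro: dvd_trans[of _ 16])
    then have p2: "p = 2" using prime_class[OF P(1)] M1 \<open>M1 = {#}\<close> by auto
    \<comment> \<open>Here \<open>N\<close> is 1 + 4 * 16 + \<open>sp\<close>, between 75 and 79,
      where no multiple of 16 lies.\<close>
    have "N = 65 + sp" using count M1 \<open>M1 = {#}\<close> s5_16 p2 P by (simp add: totient_prime)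
    moreover have "16 dvd N" using size_dvd[OF s5(1)] s5_16 by simp
    moreover have "10 \<le> sp" "sp \<le> 14" using b s5_16 ge10[OF sp(1)] by auto
    ultimately show False by presburger
  qed
  have s5_values: "s5 = 6 \<or> s5 = 16"
  proof -
    have "[s5 = 1] (mod 5)" using sylow_prime_cong[OF P(3) _ s5(1)] not25 by simp
    moreover have "s5 \<le> 25" using b ge[OF sp(1)] by auto
    ultimately show ?thesis
      using mem_upt_range[of 6 s5 26] \<open>s5 > 5\<close> nd[OF s5(1)] by (auto simp: cong_def simp del: set_upt)
  qed
  then have "even N" using size_dvd[OF s5(1)] dvd_trans[of 2 s5 N] by auto
  then obtain s2 where s2: "(2, s2) \<in># M" "odd s2" using prime_class[OF P(1)] by metis
  show False
  proof (cases "s5 = 16")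
    case True
    \<comment> \<open>Size 16 for order 5 and at least 5 for order 2 leave \<open>s3\<close> between
      5 and 9. Only 7 is 1 modulo 3 there, and 7 does not divide \<open>N\<close>.\<close>
    have "\<not> 3 dvd N"
    proof
      assume "3 dvd N"
      then obtain s3 where s3: "(3, s3) \<in># M" "\<not> 3 dvd s3" using prime_class[OF P(2)] by metis
      obtain M2 where M2: "M = add_mset (2, s2) (add_mset (3, s3) (add_mset (5, s5) M2))"
        using triple_decomposition[OF s2(1) s3(1) s5(1)] by auto
      have "s2 + s3 + s5 + (\<Sum>x\<in>#M2. snd x) \<le> 30" using total M2 by simp
      moreover from this have "M2 = {#}"
        using rest_empty[of "{#(2, s2), (3, s3), (5, s5)#}" M2 5] M2 ge ge[OF s2(1)] ge[OF s3(1)] True by auto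
      ultimately have "s2 + s3 \<le> 14" "[s3 = 1] (mod 3)" using True prime_cong[OF P(2) \<open>3 dvd N\<close>] M2 by auto
      then show False
        using mem_upt_range[of 5 s3 10] ge[OF s2(1)] ge[OF s3(1)] nd[OF s3(1)] by (auto simp: cong_def simp del: set_upt)
    qed
    then have n3: "\<not> 3 dvd s2" using size_dvd[OF s2(1)] dvd_trans by blast
    obtain M2 where M2: "M = add_mset (2, s2) (add_mset (5, s5) M2)"
      using pair_decomposition[OF s2(1) s5(1)] by auto
    have "s2 \<le> 14" using total M2 True by simp
    then have "s2 = 5"
      using mem_upt_range[of 5 s2 15] n3 s2(2) nd[OF s2(1)] ge[OF s2(1)] by (auto simp del: set_upt)
    then have "N dvd 120" using dvd_fact[OF s2(1)] by (simp add: fact_numeral)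
    moreover have "80 dvd N" using mult_dvd[OF s5(1)] True by simp
    ultimately have "80 dvd (120::nat)" using dvd_trans by blast
    then show False by simp
  next
    case False
    then have s5_6: "s5 = 6" using s5_values by simp
    then have "3 dvd N" using size_dvd[OF s5(1)] by (auto intro: dvd_trans[of _ 6])
    then obtain s3 where s3: "(3, s3) \<in># M" "\<not> 3 dvd s3" using prime_class[OF P(2)] by metis
    obtain M2 where M2: "M = add_mset (2, s2) (add_mset (3, s3) (add_mset (5, s5) M2))"
      using triple_decomposition[OF s2(1) s3(1) s5(1)] by auto
    have b2: "s2 + s3 + 6 + (\<Sum>x\<in>#M2. snd x) \<le> 30" using total M2 s5_6 by simp
    have N720: "N dvd 720" using dvd_fact[OF s5(1)] s5_6 by (simp add: fact_numeral)
    have N30: "30 dvd N" using mult_dvd[OF s5(1)] s5_6 by simp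
    have "s2 dvd 720" using size_dvd[OF s2(1)] N720 dvd_trans by blast
    have "s2 \<le> 19" using b2 ge[OF s3(1)] by simp
    then have "s2 = 5 \<or> s2 = 9 \<or> s2 = 15"
      using mem_upt_range[of 5 s2 20] s2(2) \<open>s2 dvd 720\<close> ge[OF s2(1)] by (auto simp del: set_upt)
    then consider "s2 = 15" | "s2 = 9" | "s2 = 5" by auto
    then show False
    proof cases
      case 1
      \<comment> \<open>Only 30 - 15 - 6 = 9 is left for \<open>s3\<close>. This is where
        \<open>A_5\<close> barely fails, since its class of order 3 has size 10.\<close>
      have "M2 = {#}"
        using rest_empty[of "{#(2, s2), (3, s3), (5, s5)#}" M2 5] M2 ge ge[OF s3(1)] 1 b2 by auto
      then have "[s3 = 1] (mod 3)" using prime_cong[OF P(2) \<open>3 dvd N\<close>] M2 by auto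
      then show False
        using mem_upt_range[of 5 s3 10] 1 b2 ge[OF s3(1)] nd[OF s3(1)] by (auto simp: cong_def simp del: set_upt)
    next
      case 2
      have "9 dvd N" using size_dvd[OF s2(1)] 2 by simp
      \<comment> \<open>45 is 5 times \<open>s2\<close>: the centralizer of an involution has order
        divisible by 5, so a class of order 10 has to fit into the budget too.\<close>
      have "45 dvd N" using \<open>9 dvd N\<close> N30 by presburger
      then obtain s10 where s10: "(10, s10) \<in># M"
        using involution_class[OF s2(1) P(3)] 2 by auto
      \<comment> \<open>9 does not divide \<open>5!\<close>.\<close>
      have ge6: "6 \<le> s" if "(m, s) \<in># M" for m s
      proof (rule ccontr)
        assume "\<not> 6 \<le> s"
        then have "fact s dvd (fact 5 :: nat)" by (intro fact_dvd) simp
        then have "9 dvd (fact 5 :: nat)" using \<open>9 dvd N\<close> dvd_fact[OF that] dvd_trans by blast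
        then show False by (simp add: fact_numeral)
      qed
      have "(10, s10) \<in># M2" using s10 M2 by auto
      then obtain M3 where M3: "M2 = add_mset (10, s10) M3" using multi_member_split by metis
      have "M3 = {#}"
        using rest_empty[of "{#(2, s2), (3, s3), (5, s5), (10, s10)#}" M3 6] M2 M3 ge6 ge6[OF s3(1)] ge6[OF s10] 2 b2 by auto
      then have "[s3 = 1] (mod 3)" using prime_cong[OF P(2) \<open>3 dvd N\<close>] M2 M3 by auto
      moreover have "s3 \<le> 9" using b2 2 M3 ge6[OF s10] by simp
      ultimately show False
        using mem_upt_range[of 5 s3 10] ge[OF s3(1)] nd[OF s3(1)] by (auto simp: cong_def simp del: set_upt)
    next
      case 3
      have N120: "N dvd 120" using dvd_fact[OF s2(1)] 3 by (simp add: fact_numeral)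
      \<comment> \<open>15 is 3 times \<open>s2\<close>, so an element of order 3 centralizes an
        involution.\<close>
      have "15 dvd N" using N30 by presburger
      then obtain s6 where s6: "(6, s6) \<in># M"
        using involution_class[OF s2(1) P(2)] 3 by auto
      have not9: "\<not> 3\<^sup>2 dvd N" using N120 dvd_trans[of 9 N 120] by auto
      have s10: "10 \<le> s" if "(3, s) \<in># M" for s
      proof -
        have "[s = 1] (mod 3)" using sylow_prime_cong[OF P(2) not9 that] .
        then show ?thesis
          using mem_upt_range[of 5 s 10] ge[OF that] nd[OF that] by (cases "10 \<le> s") (auto simp: cong_def simp del: set_upt)
      qed
      obtain s' where s': "(3, s') \<in># M" "s' dvd s6" using divisor_class[OF s6, of 3] by auto
      have "s6 > 0" using ge[OF s6] by simp
      \<comment> \<open>\<open>s6\<close> is a multiple of the size of some class of order 3, each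
        of which has size at least 10. The total is then at least 5 + 10 + 6 + 10 = 31.\<close>
      then have "s6 \<ge> 10" using s10[OF s'(1)] s'(2) by (meson dvd_imp_le le_trans)
      have "(6, s6) \<in># M2" using s6 M2 by auto
      then obtain M3 where M3: "M2 = add_mset (6, s6) M3" using multi_member_split by metis
      then show False using b2 3 s10[OF s3(1)] \<open>s6 \<ge> 10\<close> by simp
    qed
  qed
qed

text \<open>The orders with only the primes 2 and 3, treated by counting rather than by Burnside's
  theorem. The odd size \<open>s2\<close> is a power of 3: the value 3 would bound \<open>N\<close>
  by \<open>3!\<close>, and 27 exceeds the budget, so it is 9. Then 9 divides \<open>N\<close>, no
  size is below 6, and \<open>s3\<close>, a power of 2, is 8 or 16.\<close>

lemma no_max_prime_3:
  assumes q: "3 dvd N" and max: "\<And>p. prime p \<Longrightarrow> p dvd N \<Longrightarrow> p \<le> 3"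
  shows False
proof -
  have P: "prime (2::nat)" "prime (3::nat)" "prime (5::nat)" "prime (7::nat)" "prime (11::nat)" "prime (13::nat)"
     "prime (17::nat)"  "prime (19::nat)" "prime (23::nat)"  by simp_all
  have not_dvd: "\<not> 5 dvd N" "\<not> 7 dvd N" "\<not> 11 dvd N" "\<not> 13 dvd N" "\<not> 17 dvd N" "\<not> 19 dvd N" "\<not> 23 dvd N"
    using max P by (metis numeral_le_iff semiring_norm)+
  have ge: "3 \<le> s" if "(m, s) \<in># M" for m s using that prime_le_size q P by blast
  have nd: "\<not> 5 dvd s" "\<not> 7 dvd s" "\<not> 11 dvd s" "\<not> 13 dvd s" "\<not> 17 dvd s" "\<not> 19 dvd s" "\<not> 23 dvd s" if "(m, s) \<in># M" for m s
    using size_dvd[OF that] not_dvd dvd_trans by blast+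
  obtain s3 where s3: "(3, s3) \<in># M" "\<not> 3 dvd s3" using prime_class[OF P(2) q] .
  have "s3 \<noteq> 1" using size_ge_2[OF s3(1)] by simp
  then obtain p where p: "prime p" "p dvd s3" using prime_factor_nat by blast
  then have pN: "p dvd N" using size_dvd s3(1) dvd_trans by blast
  have "p \<noteq> 3" using p s3 by auto
  then have "p = 2" using max[OF p(1) pN] p(1) prime_ge_2_nat[of p] by linarith
  then obtain s2 where s2: "(2, s2) \<in># M" "odd s2" using prime_class[OF P(1)] pN by metis
  obtain M1 where M1: "M = add_mset (2, s2) (add_mset (3, s3) M1)"
    using pair_decomposition s2(1) s3(1) by (metis numeral_eq_iff semiring_norm(89))
  have b: "s2 + s3 + (\<Sum>x\<in>#M1. snd x) \<le> 30" using total M1 by simp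
  have "s3 \<noteq> 3" using s3(2) by auto
  then have "4 \<le> s3" using ge[OF s3(1)] by simp
  have "s2 \<noteq> 3"
  proof
    assume "s2 = 3"
    then have "N dvd 6" using dvd_fact[OF s2(1)] by (simp add: fact_numeral)
    then have "3 * s3 dvd 6" using mult_dvd[OF s3(1)] dvd_trans by blast
    then have "3 * s3 \<le> 6" by (intro dvd_imp_le) auto
    then show False using \<open>4 \<le> s3\<close> by simp
  qed
  moreover have "s2 \<le> 26" using b \<open>4 \<le> s3\<close> by simp
  ultimately have "s2 = 9"
    using mem_upt_range[of 3 s2 27] s2(2) ge[OF s2(1)] nd[OF s2(1)] by (auto simp del: set_upt)
  then have "9 dvd N" using size_dvd[OF s2(1)] by simp
  have ge6: "6 \<le> s" if "(m, s) \<in># M" for m s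
  proof (rule ccontr)
    assume "\<not> 6 \<le> s"
    then have "fact s dvd (fact 5 :: nat)" by (intro fact_dvd) simp
    then have "9 dvd (fact 5 :: nat)" using \<open>9 dvd N\<close> dvd_fact[OF that] dvd_trans by blast
    then show False by (simp add: fact_numeral)
  qed
  have "s3 \<le> 21" using b \<open>s2 = 9\<close> by simp
  then have "s3 = 8 \<or> s3 = 16"
    using mem_upt_range[of 6 s3 22] s3(2) ge6[OF s3(1)] nd[OF s3(1)] by (auto simp del: set_upt)
  have U: "[s3 + (\<Sum>x\<in>#M1. if fst x = 3 then snd x else 0) = 1] (mod 3)"
    using prime_cong[OF P(2) q] M1 by simp
  show False
  proof (cases "s3 = 16")
    case True
    then have "M1 = {#}" using rest_empty[of "{#(2, s2), (3, s3)#}" M1 6] M1 ge6 b \<open>s2 = 9\<close> by auto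
    then have "N = 42" using count M1 True \<open>s2 = 9\<close> P by (simp add: totient_prime)
    then show False using \<open>9 dvd N\<close> by simp
  next
    case False
    then have "s3 = 8" using \<open>s3 = 8 \<or> s3 = 16\<close> by simp
    \<comment> \<open>8 is 2 modulo 3, so another class of order 3 has to correct the sum.\<close>
    have "M1 \<noteq> {#}" using U \<open>s3 = 8\<close> by (auto simp: cong_def)
    then obtain x where "x \<in># M1" "fst x = 3"
    proof -
      have "\<exists>x\<in>#M1. fst x = 3"
      proof (rule ccontr)
        assume "\<not> ?thesis"
        then have "(\<Sum>x\<in>#M1. if fst x = 3 then snd x else 0) = (\<Sum>x\<in>#M1. 0)"
          by (intro arg_cong[of _ _ sum_mset] image_mset_cong) auto
        also have "\<dots> = 0" by simp
        finally have z: "(\<Sum>x\<in>#M1. if fst x = 3 then snd x else 0) = 0" .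
        show False using U \<open>s3 = 8\<close> unfolding z by (simp add: cong_def)
      qed
      then show ?thesis using that by blast
    qed
    then obtain t where t: "(3, t) \<in># M1" by (metis prod.collapse)
    then obtain M2 where M2: "M1 = add_mset (3, t) M2" using multi_member_split by metis
    have tM: "(3, t) \<in># M" using t M1 by simp
    have "t \<le> 13" using b M2 \<open>s2 = 9\<close> \<open>s3 = 8\<close> by simp
    show False
    proof (cases "M2 = {#}")
      case True
      then have "[8 + t = 1] (mod 3)" using U M2 \<open>s3 = 8\<close> by simp
      then have "t = 8"
        using mem_upt_range[of 6 t 14] \<open>t \<le> 13\<close> ge6[OF tM] nd[OF tM] by (auto simp: cong_def simp del: set_upt)
      \<comment> \<open>Two classes of size 8 contribute as many elements as one of size 16: 1 + 9 +
        32, which 9 does not divide.\<close>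
      then have "N = 42" using count M1 M2 True \<open>s2 = 9\<close> \<open>s3 = 8\<close> P by (simp add: totient_prime)
      then show False using \<open>9 dvd N\<close> by simp
    next
      case False
      then obtain m u where u: "(m, u) \<in># M2" by auto
      then obtain M3 where M3: "M2 = add_mset (m, u) M3" using multi_member_split by metis
      have uM: "(m, u) \<in># M" using u M1 M2 by simp
      have "t + u + (\<Sum>x\<in>#M3. snd x) \<le> 13" using b M2 M3 \<open>s2 = 9\<close> \<open>s3 = 8\<close> by simp
      then have "t \<le> 7" "u \<le> 7" using ge6[OF tM] ge6[OF uM] by auto
      \<comment> \<open>Size 7 is impossible as 7 does not divide \<open>N\<close>. Adding 6 once or
        twice leaves 8 at 2 modulo 3.\<close>
      then have "t = 6" "u = 6"
        using mem_upt_range[of 6 t 8] mem_upt_range[of 6 u 8] ge6[OF tM] ge6[OF uM] nd[OF tM] nd[OF uM]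
        by (auto simp del: set_upt)
      moreover from this have "M3 = {#}" using \<open>t + u + _ \<le> 13\<close> rest_empty[of "{#(2, s2), (3, s3), (3, t), (m, u)#}" M3 6] M1 M2 M3 ge6
        ge6[OF tM] ge6[OF uM] by auto
      ultimately show False using U M2 M3 \<open>s3 = 8\<close> by (simp add: cong_def split: if_splits)
    qed
  qed
qed


text \<open>Once 49 is excluded, \<open>s7\<close> is 8 or 15, as 22 would bring in the prime 11.
  Only 8 survives; then 5 and 3 are ruled out as divisors, and \<open>s2\<close> = 7 bounds
  \<open>N\<close> by \<open>7!\<close>, which leaves the orders 56 and 112.\<close>

lemma no_max_prime_7:
  assumes q: "7 dvd N" and max: "\<And>p. prime p \<Longrightarrow> p dvd N \<Longrightarrow> p \<le> 7"
  shows False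
proof -
  have P: "prime (2::nat)" "prime (3::nat)" "prime (5::nat)" "prime (7::nat)" "prime (11::nat)" "prime (13::nat)"
     "prime (17::nat)"  "prime (19::nat)"  by simp_all
  have not_dvd: "\<not> 11 dvd N" "\<not> 13 dvd N" "\<not> 17 dvd N" "\<not> 19 dvd N"
    using max P by (metis numeral_le_iff semiring_norm)+
  have ge: "7 \<le> s" if "(m, s) \<in># M" for m s using that prime_le_size q P by blast
  have nd: "\<not> 11 dvd s" "\<not> 13 dvd s" "\<not> 17 dvd s" "\<not> 19 dvd s" if "(m, s) \<in># M" for m s
    using size_dvd[OF that] not_dvd dvd_trans by blast+
  obtain s7 where s7: "(7, s7) \<in># M" "\<not> 7 dvd s7" using prime_class[OF P(4) q] .
  have "s7 \<noteq> 7" "s7 \<noteq> 14" using s7(2) by auto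
  have "s7 \<noteq> 1" using size_ge_2[OF s7(1)] by simp
  then obtain p where p: "prime p" "p dvd s7" using prime_factor_nat by blast
  then have "p dvd N" using size_dvd s7(1) dvd_trans by blast
  then obtain sp where sp: "(p, sp) \<in># M" "\<not> p dvd sp" using prime_class p(1) by metis
  have "p \<noteq> 7" using p s7 by auto
  then obtain M1 where M1: "M = add_mset (7, s7) (add_mset (p, sp) M1)"
    using pair_decomposition s7(1) sp(1) by metis
  have b: "s7 + sp + (\<Sum>x\<in>#M1. snd x) \<le> 30" using total M1 by simp
  have not49: "\<not> 49 dvd N"
  proof
    assume d: "49 dvd N"
    \<comment> \<open>\<open>13!\<close> contains the factor 7 only once.\<close>
    have ge14: "14 \<le> s" if "(m, s) \<in># M" for m s
    proof (rule ccontr)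
      assume "\<not> 14 \<le> s"
      then have "fact s dvd (fact 13 :: nat)" by (intro fact_dvd) simp
      then have "49 dvd (fact 13 :: nat)" using d dvd_fact[OF that] dvd_trans by blast
      then show False by (simp add: fact_numeral)
    qed
    have "M1 = {#}"
      using rest_empty[of "{#(7, s7), (p, sp)#}" M1 14] ge14 M1 b ge14[OF sp(1)] ge14[OF s7(1)] by auto
    then have "[s7 = 1] (mod 7)" using prime_cong[OF P(4) q] M1 \<open>p \<noteq> 7\<close> by simp
    moreover have "14 \<le> s7" "s7 \<le> 16" using ge14[OF sp(1)] ge14[OF s7(1)] b by auto
    ultimately have "s7 = 15"
      using mem_upt_range[of 14 s7 17] by (auto simp: cong_def simp del: set_upt)
    \<comment> \<open>The single class besides the one of order 7 cannot account for both 3 and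
      5.\<close>
    then have "3 dvd N" "5 dvd N"
      using size_dvd[OF s7(1)] dvd_trans[of 3 s7 N] dvd_trans[of 5 s7 N] by auto
    then have "p = 3" "p = 5" using prime_class[OF P(2)] prime_class[OF P(3)] M1 \<open>M1 = {#}\<close> by auto
    then show False by simp
  qed
  have "s7 = 8 \<or> s7 = 15"
  proof -
    have "[s7 = 1] (mod 7)" using sylow_prime_cong[OF P(4) _ s7(1)] not49 by simp
    moreover have "s7 \<le> 23" using b ge[OF sp(1)] by auto
    ultimately show ?thesis
      using mem_upt_range[of 7 s7 24] ge[OF s7(1)] nd[OF s7(1)] by (auto simp: cong_def simp del: set_upt)
  qed
  moreover have "s7 \<noteq> 15"
  proof
    assume "s7 = 15"
    then have d: "3 dvd N" "5 dvd N"
      using size_dvd[OF s7(1)] dvd_trans[of 3 s7 N] dvd_trans[of 5 s7 N] by auto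
    obtain s3 where s3: "(3, s3) \<in># M" using prime_class[OF P(2) d(1)] .
    obtain s5 where s5: "(5, s5) \<in># M" using prime_class[OF P(3) d(2)] .
    obtain M2 where M2: "M = add_mset (3, s3) (add_mset (5, s5) (add_mset (7, s7) M2))"
      using triple_decomposition[OF s3 s5 s7(1)] by auto
    have b2: "15 + s3 + s5 + (\<Sum>x\<in>#M2. snd x) \<le> 30" using total M2 \<open>s7 = 15\<close> by simp
    then have "M2 = {#}"
      using rest_empty[of "{#(3, s3), (5, s5), (7, s7)#}" M2 7] M2 ge ge[OF s3] ge[OF s5] by auto
    then have "[s5 = 1] (mod 5)" using prime_cong[OF P(3) d(2)] M2 by simp
    moreover have "s5 \<le> 8" using b2 ge[OF s3] by simp
    ultimately show False
      using mem_upt_range[of 7 s5 9] ge[OF s5] by (auto simp: cong_def simp del: set_upt)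
  qed
  ultimately have "s7 = 8" by simp
  then have "even N" using size_dvd[OF s7(1)] dvd_trans[of 2 s7 N] by auto
  then obtain s2 where s2: "(2, s2) \<in># M" "odd s2" using prime_class[OF P(1)] by metis
  have N56: "56 dvd N" using mult_dvd[OF s7(1)] \<open>s7 = 8\<close> by simp
  have not5: "\<not> 5 dvd N"
  proof
    assume d: "5 dvd N"
    then obtain s5 where s5: "(5, s5) \<in># M" using prime_class[OF P(3)] by metis
    obtain M2 where M2: "M = add_mset (2, s2) (add_mset (5, s5) (add_mset (7, s7) M2))"
      using triple_decomposition[OF s2(1) s5 s7(1)] by auto
    have b2: "8 + s2 + s5 + (\<Sum>x\<in>#M2. snd x) \<le> 30" using total M2 \<open>s7 = 8\<close> by simp
    have U: "[s5 + (\<Sum>x\<in>#M2. if fst x = 5 then snd x else 0) = 1] (mod 5)"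
      using prime_cong[OF P(3) d] M2 by simp
    show False
    proof (cases "M2 = {#}")
      case True
      then show False
        using U b2 ge[OF s2(1)] mem_upt_range[of 7 s5 16] ge[OF s5] nd[OF s5]
        by (auto simp: cong_def simp del: set_upt)
    next
      case False
      then obtain m u where mu: "M2 = {#(m, u)#}"
        using rest_one[of "{#(2, s2), (5, s5), (7, s7)#}" M2 7] M2 b2 ge ge[OF s2(1)] ge[OF s5] by auto
      then have "(m, u) \<in># M" using M2 by simp
      then have "7 \<le> u" "7 \<le> s5" "s5 + u \<le> 15" using ge ge[OF s5] ge[OF s2(1)] b2 mu by auto
      \<comment> \<open>The sizes for order 5 add up to \<open>s5\<close> or \<open>s5 + u\<close>,
        depending on whether \<open>m\<close> is 5. None of 7, 8, 14, 15 is 1 modulo 5.\<close>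
      then have "s5 + u = 14 \<or> s5 + u = 15" "s5 = 7 \<or> s5 = 8" by auto
      then show False using U mu by (auto simp: cong_def split: if_splits)
    qed
  qed
  show False
  proof (cases "3 dvd N")
    case True
    then obtain s3 where s3: "(3, s3) \<in># M" using prime_class[OF P(2)] by metis
    obtain M2 where M2: "M = add_mset (2, s2) (add_mset (3, s3) (add_mset (7, s7) M2))"
      using triple_decomposition[OF s2(1) s3 s7(1)] by auto
    have b2: "8 + s2 + s3 + (\<Sum>x\<in>#M2. snd x) \<le> 30" using total M2 \<open>s7 = 8\<close> by simp
    have "168 dvd N" using N56 True by presburger
    then have "168 \<le> N" using N_gt_1 by (intro dvd_imp_le) auto
    have N: "N = 49 + s2 + 2 * s3 + (\<Sum>x\<in>#M2. snd x * totient (fst x))"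
      using count M2 \<open>s7 = 8\<close> P by (simp add: totient_prime)
    \<comment> \<open>Without a fourth class \<open>N\<close> would be at most 49 + 2 * 22, well
      below 168.\<close>
    have "M2 \<noteq> {#}" using \<open>168 \<le> N\<close> N b2 by auto
    then obtain m u where mu: "M2 = {#(m, u)#}"
      using rest_one[of "{#(2, s2), (3, s3), (7, s7)#}" M2 7] M2 b2 ge ge[OF s2(1)] ge[OF s3] by auto
    then have "(m, u) \<in># M" using M2 by simp
    then have "7 \<le> u" using ge by blast
    moreover have "s2 + s3 + u \<le> 22" using b2 mu by simp
    ultimately have "u \<le> 8" "s2 \<le> 8" "s3 \<le> 8" using ge[OF s3] ge[OF s2(1)] by linarith+
    then have "s2 = 7" using s2(2) ge[OF s2(1)] by (cases "s2 = 8") auto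
    have "21 dvd N" using True q by presburger
    then obtain s6 where "(6, s6) \<in># M" using involution_class[OF s2(1) P(2)] \<open>s2 = 7\<close> by auto
    then have "m = 6" using M2 mu by auto
    \<comment> \<open>This crude bound is enough: \<open>N\<close> is at most 49 + 7 + 16 + 40 =
      112.\<close>
    have "totient 6 < 6" by (intro totient_less) simp
    then have "u * totient 6 \<le> 8 * 5" using \<open>u \<le> 8\<close> by (intro mult_mono) auto
    then show False using N mu \<open>m = 6\<close> \<open>168 \<le> N\<close> \<open>s2 = 7\<close> \<open>s3 \<le> 8\<close> by simp
  next
    case False
    obtain M1 where M1: "M = add_mset (2, s2) (add_mset (7, s7) M1)"
      using pair_decomposition[OF s2(1) s7(1)] by auto
    have b2: "8 + s2 + (\<Sum>x\<in>#M1. snd x) \<le> 30" using total M1 \<open>s7 = 8\<close> by simp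
    have nd35: "\<not> 3 dvd s" "\<not> 5 dvd s" if "(m, s) \<in># M" for m s
      using size_dvd[OF that] False not5 dvd_trans by blast+
    have "s2 = 7"
      using mem_upt_range[of 7 s2 23] b2 s2(2) ge[OF s2(1)] nd[OF s2(1)] nd35[OF s2(1)] by (auto simp del: set_upt)
    then have "N dvd 5040" using dvd_fact[OF s2(1)] by (simp add: fact_numeral)
    have N: "N = 56 + (\<Sum>x\<in>#M1. snd x * totient (fst x))"
      using count M1 \<open>s7 = 8\<close> \<open>s2 = 7\<close> P by (simp add: totient_prime)
    obtain k where k: "N = 56 * k" using N56 by (elim dvdE)
    \<comment> \<open>5040 = 56 * 90, and the divisors of 90 prime to 3 and 5 are 1 and 2.\<close>
    then have "56 * k dvd 56 * 90" using \<open>N dvd 5040\<close> by simp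
    then have "k dvd 90" by (subst (asm) dvd_times_left_cancel_iff) auto
    then have "k \<le> 90" by (intro dvd_imp_le) auto
    have "\<not> 3 dvd k" "\<not> 5 dvd k" "k \<noteq> 0" using False not5 k N_gt_1 by auto
    then have "k = 1 \<or> k = 2"
      using mem_upt_range[of 2 k 91] \<open>k dvd 90\<close> \<open>k \<le> 90\<close> by (cases "k = 1") (auto simp del: set_upt)
    then consider "N = 56" | "N = 112" using k by auto
    then show False
    proof cases
      case 1
      have "M1 = {#}"
      proof (rule ccontr)
        assume "M1 \<noteq> {#}"
        then obtain m u where mu: "(m, u) \<in># M1" by auto
        then obtain M3 where "M1 = add_mset (m, u) M3" using multi_member_split by metis
        then have "u * totient m = 0" using N 1 by simp
        then show False using ge[of m u] order_ge_2[of m u] mu M1 by auto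
      qed
      \<comment> \<open>The counts are those of the affine group over the field with 8 elements. The
        identity and 7 involutions make up just 8 elements, so the Sylow 2-subgroup would be normal,
        against \<open>sylow_less\<close>.\<close>
      then show False
        using sylow_less[of 2 3] 1 M1 \<open>s2 = 7\<close> by simp
    next
      case 2
      \<comment> \<open>The remaining classes have to supply 56 elements with sizes of total at most
        15, so there are at most two of them.\<close>
      have sum56: "(\<Sum>x\<in>#M1. snd x * totient (fst x)) = 56" using N 2 by simp
      have b15: "(\<Sum>x\<in>#M1. snd x) \<le> 15" using b2 \<open>s2 = 7\<close> by simp
      have M1D: "m * u dvd 112" "7 \<le> u" "2 \<le> m" "m dvd 112" "u dvd 112" if "(m, u) \<in># M1" for m u
        using that mult_dvd[of m u] ge[of m u] order_ge_2[of m u] order_dvd[of m u] size_dvd[of m u] M1 2 by auto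
      have tots: "totient 4 = 2" "totient 8 = 4" "totient 16 = 8" "totient 14 = 6" by code_simp+
      show False
      proof (cases "\<exists>u. (4, u) \<in># M1")
        case True
        then obtain u where u: "(4, u) \<in># M1" by blast
        then obtain M3 where M3: "M1 = add_mset (4, u) M3" using multi_member_split by metis
        have "u \<le> 15" using b15 M3 by simp
        then have u7: "u = 7 \<or> u = 14"
          using M1D[OF u] mem_upt_range[of 7 u 16] by (auto simp del: set_upt)
        have "M3 \<noteq> {#}" using sum56 M3 u7 tots by auto
        have "\<exists>m v. M3 = {#(m, v)#}"
          by (rule rest_one[of "{#(2, s2), (7, s7), (4, u)#}" M3 7]) (use M1 M3 b15 u7 ge \<open>M3 \<noteq> {#}\<close> in auto)
        then obtain m v where mv: "M3 = {#(m, v)#}" by blast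
        have v: "(m, v) \<in># M1" using M3 mv by simp
        then have "u = 7" "v = 7 \<or> v = 8" using u7 b15 M3 mv M1D[OF v] by auto
        \<comment> \<open>The class of order 4 and size 7 supplies 14 of the 56 elements. As 8 does
          not divide 42, the other class has size 7 and an order \<open>m\<close> dividing 16 with
          totient 6, but these totients are powers of 2.\<close>
        then have "v * totient m = 42" using sum56 M3 mv tots by simp
        have "8 * t \<noteq> 42" for t :: nat by presburger
        then have "v = 7" using \<open>v = 7 \<or> v = 8\<close> \<open>v * totient m = 42\<close> by metis
        then have "totient m = 6" "m * 7 dvd 16 * 7" using \<open>v * totient m = 42\<close> M1D[OF v] by auto
        then have "m dvd 16" by (subst (asm) dvd_times_right_cancel_iff) auto
        moreover from this have "m \<le> 16" by (intro dvd_imp_le) auto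
        ultimately show False
          using \<open>totient m = 6\<close> tots M1D(3)[OF v] mem_upt_range[of 2 m 17] by (auto simp del: set_upt)
      next
        case no4: False
        \<comment> \<open>Without a class of order 4, no order is a multiple of 4, which leaves few
          divisors of 112.\<close>
        have M1E: "(m = 2 \<or> m = 7 \<or> m = 14) \<and> (totient m = 1 \<or> totient m = 6)"
          if mu: "(m, u) \<in># M1" for m u
        proof -
          have "\<not> 4 dvd m"
          proof
            assume "4 dvd m"
            then obtain s' where "(4, s') \<in># M" using divisor_class[of m u 4] mu M1 by auto
            then show False using no4 M1 by auto
          qed
          moreover have "m \<le> 112" using M1D(4)[OF mu] by (intro dvd_imp_le) auto
          ultimately have "m = 2 \<or> m = 7 \<or> m = 14"
            using M1D(3,4)[OF mu] mem_upt_range[of 2 m 113] by (auto simp del: set_upt)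
          then show ?thesis using tots P by (auto simp: totient_prime)
        qed
        have u: "u = 7 \<or> u = 8 \<or> u = 14" if "(m, u) \<in># M1" "u \<le> 15" for m u
          using M1D[OF that(1)] that(2) mem_upt_range[of 7 u 16] by (auto simp del: set_upt)
        have "M1 \<noteq> {#}" using sum56 by auto
        then obtain m u where mu: "(m, u) \<in># M1" by auto
        then obtain M3 where M3: "M1 = add_mset (m, u) M3" using multi_member_split by metis
        have "u \<le> 15" using b15 M3 by simp
        note u' = u[OF mu this] M1E[OF mu]
        have "7 \<le> u" using M1D(2)[OF mu] .
        show False
        proof (cases "M3 = {#}")
          case True
          then show False using u' sum56 M3 by auto
        next
          case False
          have "\<exists>n v. M3 = {#(n, v)#}"
            by (rule rest_one[of "{#(2, s2), (7, s7), (m, u)#}" M3 7]) (use M1 M3 b15 \<open>7 \<le> u\<close> ge False in auto)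
          then obtain n v where nv: "M3 = {#(n, v)#}" by blast
          have v: "(n, v) \<in># M1" "v \<le> 15" using M3 nv b15 by auto
          have "u + v \<le> 15" using b15 M3 nv by simp
          then have uv: "u = 7 \<or> u = 8" "v = 7 \<or> v = 8" "u + v \<le> 15"
            using u' u[OF v] \<open>7 \<le> u\<close> M1D(2)[OF v(1)] by auto
          \<comment> \<open>The only solution with sizes 7 and 8 is 8 * 6 + 8 * 1, whose sizes add
            up to 16 and exceed the 15 available.\<close>
          have "u * totient m + v * totient n = 56" using sum56 M3 nv by simp
          moreover have "totient m = 1 \<or> totient m = 6" "totient n = 1 \<or> totient n = 6"
            using M1E[OF mu] M1E[OF v(1)] by blast+
          ultimately show False using uv by auto
        qed
      qed
    qed
  qed
qed

theorem contradiction: False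
proof -
  have N0: "N \<noteq> 0" using N_gt_1 by simp
  define q where "q = Max (prime_factors N)"
  have "prime_factors N \<noteq> {}" using N_gt_1 by (simp add: prime_factorization_empty_iff)
  then have "q \<in> prime_factors N" unfolding q_def by (intro Max_in) auto
  then have q: "prime q" "q dvd N" by auto
  have max: "p \<le> q" if "prime p" "p dvd N" for p
    unfolding q_def using that N0 by (intro Max_ge) (auto simp: prime_factors_dvd)
  obtain sq where sq: "(q, sq) \<in># M" "\<not> q dvd sq" using prime_class[OF q] .
  have ge: "q \<le> s" if "(m, s) \<in># M" for m s using that prime_le_size q by blast
  have "sq > q" using ge[OF sq(1)] sq(2) by (cases "sq = q") auto
  have "sq \<noteq> 1" using size_ge_2[OF sq(1)] by simp
  then obtain p where p: "prime p" "p dvd sq" using prime_factor_nat by blast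
  then have pN: "p dvd N" using size_dvd sq(1) dvd_trans by blast
  then obtain sp where sp: "(p, sp) \<in># M" using prime_class p(1) by metis
  have "p \<noteq> q" using p sq by auto
  then obtain M1 where M1: "M = add_mset (q, sq) (add_mset (p, sp) M1)"
    using pair_decomposition sq(1) sp by metis
  have "sq + sp + (\<Sum>x\<in>#M1. snd x) \<le> 30" using total M1 by simp
  then have "q \<le> 14" using \<open>sq > q\<close> ge[OF sp] by simp
  moreover have "2 < q" using max[OF p(1) pN] \<open>p \<noteq> q\<close> prime_ge_2_nat[OF p(1)] by simp
  moreover have "q \<noteq> 4" "q \<noteq> 6" "q \<noteq> 8" "q \<noteq> 9" "q \<noteq> 10" "q \<noteq> 12" "q \<noteq> 14" using q(1) by auto
  ultimately have "q = 3 \<or> q = 5 \<or> q = 7 \<or> q \<in> {11, 13}"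
    using mem_upt_range[of 3 q 15] by (auto simp del: set_upt)
  then show False
    using no_max_prime_3 no_max_prime_5 no_max_prime_7 no_class_data_prime_11_13 q max by blast
qed

end

section \<open>Group actions and Sylow subgroups\<close>

lemma prime_dvd_if_dvd_prime_power:
  fixes p :: nat
  assumes "prime p" "n dvd p ^ a" "n \<noteq> 1"
  shows "p dvd n"
proof -
  obtain j where "n = p ^ j" using assms(1,2) divides_primepow_nat by blast
  then show ?thesis using assms(3) by (cases j) auto
qed

text \<open>\<open>group_action\<close> takes its values in \<open>Bij E\<close>, whose members are
  extensional on \<open>E\<close>; hence the \<open>restrict\<close>. Bijectivity comes from the
  action of the inverse.\<close>

lemma (in group) group_actionI:
  assumes closed: "\<And>g x. g \<in> carrier G \<Longrightarrow> x \<in> E \<Longrightarrow> f g x \<in> E"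
    and one: "\<And>x. x \<in> E \<Longrightarrow> f \<one> x = x"
    and mult: "\<And>g h x. g \<in> carrier G \<Longrightarrow> h \<in> carrier G \<Longrightarrow> x \<in> E \<Longrightarrow> f (g \<otimes> h) x = f g (f h x)"
  shows "group_action G E (\<lambda>g. restrict (f g) E)"
proof -
  have Bij: "restrict (f g) E \<in> Bij E" if g: "g \<in> carrier G" for g
  proof -
    have inv: "f (inv g) (f g x) = x" "f g (f (inv g) x) = x" if "x \<in> E" for x
      using mult[of "inv g" g x] mult[of g "inv g" x] one[OF that] g that by simp_all
    have "bij_betw (f g) E E"
      by (rule bij_betw_byWitness[of _ "f (inv g)"]) (use inv closed g in auto)
    then have "bij_betw (restrict (f g) E) E E"
      by (subst bij_betw_cong[of E _ "f g"]) auto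
    then show ?thesis by (simp add: Bij_def)
  qed
  have "(\<lambda>g. restrict (f g) E) \<in> hom G (BijGroup E)"
  proof (rule homI)
    fix g h assume gh: "g \<in> carrier G" "h \<in> carrier G"
    show "restrict (f (g \<otimes> h)) E = restrict (f g) E \<otimes>\<^bsub>BijGroup E\<^esub> restrict (f h) E"
      using Bij gh closed mult by (auto simp: BijGroup_def compose_def restrict_def fun_eq_iff)
  qed (use Bij in \<open>simp add: BijGroup_def\<close>)
  then show ?thesis
    by (simp add: group_action_def group_hom_def group_hom_axioms_def group_BijGroup)
qed

lemma (in group_action) orbit_fixed_point:
  assumes "\<forall>g\<in>carrier G. \<phi> g x = x" "x \<in> E"
  shows "orbit G \<phi> x = {x}"
  using assms orbit_refl[OF assms(2)] by (auto simp: orbit_def)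

text \<open>Orbit lengths divide the power of \<open>p\<close>, so every orbit other than a fixed
  point has length divisible by \<open>p\<close>. Summing the indicator of non-fixed points over the
  orbits gives the congruence.\<close>

lemma (in group_action) p_group_fixed_points:
  assumes "finite E" "prime p" "order G = p ^ a"
  shows "[card E = card {x\<in>E. \<forall>g\<in>carrier G. \<phi> g x = x}] (mod p)"
proof -
  let ?F = "{x\<in>E. \<forall>g\<in>carrier G. \<phi> g x = x}"
  have "p dvd (\<Sum>x\<in>orb. if x \<in> ?F then 0 else 1 :: nat)" if orb: "orb \<in> orbits G E \<phi>" for orb
  proof -
    obtain x where x: "x \<in> E" "orb = orbit G \<phi> x" using orb by (auto simp: orbits_def)
    show ?thesis
    proof (cases "x \<in> ?F")
      case True
      then show ?thesis using x orbit_fixed_point by auto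
    next
      case False
      have "y \<notin> ?F" if "y \<in> orb" for y
      proof
        assume y: "y \<in> ?F"
        then have "x \<in> orbit G \<phi> y" using orbit_sym[of x y] x that by auto
        then show False using orbit_fixed_point[of y] y False by auto
      qed
      then have "(\<Sum>x\<in>orb. if x \<in> ?F then 0 else 1 :: nat) = (\<Sum>x\<in>orb. 1)"
        by (intro sum.cong) auto
      then have "(\<Sum>x\<in>orb. if x \<in> ?F then 0 else 1 :: nat) = card orb" by simp
      moreover have "card orb dvd p ^ a"
        using orbit_stabilizer_theorem[OF x(1)] assms(3) x(2) by (metis dvd_triv_left)
      moreover have "card orb \<noteq> 1"
      proof
        assume "card orb = 1"
        then obtain y where "orb = {y}" by (auto simp: card_1_singleton_iff)
        then have "orb = {x}" using orbit_refl[OF x(1)] x(2) by auto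
        then have "\<phi> g x = x" if "g \<in> carrier G" for g
          using that x(2) by (auto simp: orbit_def)
        then show False using False x(1) by auto
      qed
      ultimately show ?thesis
        using prime_dvd_if_dvd_prime_power[OF assms(2)] by metis
    qed
  qed
  then have "p dvd (\<Sum>x\<in>E. if x \<in> ?F then 0 else 1 :: nat)"
    unfolding disjoint_sum[OF assms(1), symmetric] by (rule dvd_sum)
  also have "(\<Sum>x\<in>E. if x \<in> ?F then 0 else 1 :: nat) = card (E - ?F)"
    using assms(1) by (auto simp: sum.If_cases intro!: arg_cong[of _ _ card])
  finally have "[card (E - ?F) + card ?F = 0 + card ?F] (mod p)"
    by (intro cong_add) (auto simp: cong_0_iff)
  moreover have "card (E - ?F) + card ?F = card E"
    using assms(1) by (subst card_Un_disjoint[symmetric]) (auto intro!: arg_cong[of _ _ card])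
  ultimately show ?thesis by simp
qed

section \<open>Conjugation, centres of p-groups and Sylow subgroups\<close>

definition conj_by :: "('a, 'b) monoid_scheme \<Rightarrow> 'a \<Rightarrow> 'a \<Rightarrow> 'a" where
  "conj_by G g x = g \<otimes>\<^bsub>G\<^esub> x \<otimes>\<^bsub>G\<^esub> inv\<^bsub>G\<^esub> g"

context group
begin

lemma conj_by_closed [simp]: "g \<in> carrier G \<Longrightarrow> x \<in> carrier G \<Longrightarrow> conj_by G g x \<in> carrier G"
  by (simp add: conj_by_def)

lemma conj_by_one [simp]: "x \<in> carrier G \<Longrightarrow> conj_by G \<one> x = x"
  by (simp add: conj_by_def)

lemma conj_by_comp:
  "g \<in> carrier G \<Longrightarrow> h \<in> carrier G \<Longrightarrow> x \<in> carrier G \<Longrightarrow> conj_by G (g \<otimes> h) x = conj_by G g (conj_by G h x)"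
  by (simp add: conj_by_def inv_mult_group m_assoc)

lemma conj_by_mult:
  "g \<in> carrier G \<Longrightarrow> x \<in> carrier G \<Longrightarrow> y \<in> carrier G \<Longrightarrow> conj_by G g (x \<otimes> y) = conj_by G g x \<otimes> conj_by G g y"
  by (simp add: conj_by_def m_assoc inv_solve_left)

lemma conj_by_group_hom: "g \<in> carrier G \<Longrightarrow> group_hom G G (conj_by G g)"
  by unfold_locales (auto simp: hom_def conj_by_mult)

lemma conj_by_pow:
  "g \<in> carrier G \<Longrightarrow> x \<in> carrier G \<Longrightarrow> conj_by G g (x [^] (n::nat)) = conj_by G g x [^] n"
  by (rule group_hom.hom_nat_pow[OF conj_by_group_hom])

lemma conj_by_eq_iff:
  "g \<in> carrier G \<Longrightarrow> x \<in> carrier G \<Longrightarrow> y \<in> carrier G \<Longrightarrow> conj_by G g x = conj_by G g y \<longleftrightarrow> x = y"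
  by (simp add: conj_by_def)

lemma conj_by_fixed_iff:
  "g \<in> carrier G \<Longrightarrow> x \<in> carrier G \<Longrightarrow> conj_by G g x = x \<longleftrightarrow> g \<otimes> x = x \<otimes> g"
  using inv_solve_right[of x "g \<otimes> x" g] by (auto simp: conj_by_def)

lemma conj_by_image_eq_coset: "conj_by G g ` H = g <# H #> inv g"
  by (auto simp: conj_by_def l_coset_def r_coset_def)

lemma conj_by_image_comp:
  assumes "g \<in> carrier G" "h \<in> carrier G" "H \<subseteq> carrier G"
  shows "conj_by G (g \<otimes> h) ` H = conj_by G g ` conj_by G h ` H"
  using assms by (force simp: conj_by_comp image_image subset_iff intro!: image_cong)

lemma conj_by_one_image:
  assumes "H \<subseteq> carrier G"
  shows "conj_by G \<one> ` H = H"
proof -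
  have "conj_by G \<one> ` H = (\<lambda>x. x) ` H"
    using assms by (intro image_cong) auto
  then show ?thesis by simp
qed

lemma conj_by_image_generate:
  "g \<in> carrier G \<Longrightarrow> x \<in> carrier G \<Longrightarrow> conj_by G g ` generate G {x} = generate G {conj_by G g x}"
  using group_hom.generate_img[OF conj_by_group_hom, of g "{x}"] by simp

lemma inj_on_conj_by: "g \<in> carrier G \<Longrightarrow> H \<subseteq> carrier G \<Longrightarrow> inj_on (conj_by G g) H"
  by (auto simp: inj_on_def conj_by_eq_iff subset_iff)

lemma card_subgroup_dvd_order: "subgroup H G \<Longrightarrow> card H dvd order G"
  using lagrange by (metis dvd_triv_right)

text \<open>The centre is the fixed point set of conjugation, so \<open>p\<close> divides its size
  and it contains some \<open>y\<close> other than \<one>. If \<open>y\<close> has order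
  \<open>p ^ j\<close>, its power with exponent \<open>p ^ (j - 1)\<close> has order
  \<open>p\<close>.\<close>

lemma p_group_central_element:
  assumes "prime p" "order G = p ^ a" "0 < a"
  obtains z where "z \<in> carrier G" "z \<noteq> \<one>" "z [^] p = \<one>" "\<And>g. g \<in> carrier G \<Longrightarrow> conj_by G g z = z"
proof -
  let ?Z = "{x\<in>carrier G. \<forall>g\<in>carrier G. conj_by G g x = x}"
  have fin: "finite (carrier G)"
    using assms by (metis order_gt_0_iff_finite prime_gt_0_nat zero_less_power)
  interpret A: group_action G "carrier G" "\<lambda>g. restrict (conj_by G g) (carrier G)"
    by (rule group_actionI) (auto simp: conj_by_comp)
  have "[card (carrier G) = card ?Z] (mod p)"
    using A.p_group_fixed_points[OF fin assms(1,2)] by (simp cong: conj_cong)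
  moreover have "p dvd card (carrier G)" using assms by (simp add: order_def)
  ultimately have "p dvd card ?Z" by (simp add: cong_dvd_iff)
  moreover have "\<one> \<in> ?Z" by (auto simp: conj_by_def)
  ultimately have "\<exists>y\<in>?Z. y \<noteq> \<one>"
  proof -
    have "?Z \<noteq> {\<one>}" using \<open>p dvd card ?Z\<close> assms(1) by (auto simp: prime_nat_iff)
    then show ?thesis using \<open>\<one> \<in> ?Z\<close> by blast
  qed
  then obtain y where y: "y \<in> carrier G" "\<And>g. g \<in> carrier G \<Longrightarrow> conj_by G g y = y" "y \<noteq> \<one>" by blast
  have "ord y dvd p ^ a" using ord_dvd_group_order[OF y(1)] assms(2) by simp
  then obtain j where j: "ord y = p ^ j" using assms(1) divides_primepow_nat by blast
  have "j \<noteq> 0"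
  proof
    assume "j = 0"
    then show False using j y ord_eq_1[OF y(1)] by simp
  qed
  then have jj: "p ^ j = p ^ (j - 1) * p" by (cases j) auto
  define z where "z = y [^] (p ^ (j - 1))"
  show thesis
  proof
    show "z \<in> carrier G" using y by (simp add: z_def)
    have "\<not> ord y dvd p ^ (j - 1)"
      using power_dvd_imp_le[of p j "j - 1"] \<open>j \<noteq> 0\<close> prime_gt_1_nat[OF assms(1)] unfolding j by auto
    then show "z \<noteq> \<one>" using y by (simp add: z_def pow_eq_id)
    show "z [^] p = \<one>" using y j jj pow_ord_eq_1[OF y(1)] by (simp add: z_def nat_pow_pow)
    show "conj_by G g z = z" if "g \<in> carrier G" for g using that y by (simp add: z_def conj_by_pow)
  qed
qed

text \<open>\<open>N(P)/P\<close> has order prime to \<open>p\<close>, so the image of \<open>x\<close> in it is trivial.\<close>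

lemma sylow_normalizing_element:
  assumes "finite (carrier G)" "prime p" "subgroup P G" "card P = p ^ a" "order G = p ^ a * k" "\<not> p dvd k"
    and x: "x \<in> carrier G" "conj_by G x ` P = P" "x [^] (p ^ j) = \<one>"
  shows "x \<in> P"
proof -
  interpret P: subgroup P G by fact
  let ?H = "normalizer G P"
  let ?K = "G\<lparr>carrier := ?H\<rparr>"
  have H: "subgroup ?H G" by (rule normalizer_imp_subgroup[OF P.subset])
  interpret K: group ?K by (rule subgroup_imp_group[OF H])
  interpret N: normal P ?K by (rule subgroup_in_normalizer) fact
  interpret Q: group "?K Mod P" by (rule N.factorgroup_is_group)
  have xH: "x \<in> ?H"
    using x P.subset by (simp add: normalizer_def stabilizer_def conj_by_image_eq_coset)
  interpret h: group_hom ?K "?K Mod P" "\<lambda>y. P #>\<^bsub>?K\<^esub> y"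
    by unfold_locales (rule N.r_coset_hom_Mod)
  let ?q = "P #>\<^bsub>?K\<^esub> x"
  have q: "?q \<in> carrier (?K Mod P)" using h.hom_closed xH by simp
  have "?q [^]\<^bsub>?K Mod P\<^esub> (p ^ j) = \<one>\<^bsub>?K Mod P\<^esub>"
    using h.hom_nat_pow[of x "p ^ j"] h.hom_one xH x(3) by (simp flip: nat_pow_consistent)
  then have d1: "Q.ord ?q dvd p ^ j" using Q.pow_eq_id[OF q] by simp
  have "order (?K Mod P) * p ^ a = card ?H"
    using K.lagrange[OF N.subgroup_axioms] assms(4) by (simp add: order_def FactGroup_def)
  also have "card ?H dvd p ^ a * k" using lagrange[OF H] assms(5) by (metis dvd_triv_right)
  finally have "order (?K Mod P) dvd k"
    using prime_gt_0_nat[OF assms(2)] by (simp add: mult.commute)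
  then have d2: "Q.ord ?q dvd k" using Q.ord_dvd_group_order[OF q] dvd_trans by blast
  have "coprime (p ^ j) k" using assms(2,6) by (simp add: prime_imp_coprime)
  then have "Q.ord ?q = 1" using d1 d2 by (metis coprime_common_divisor_nat)
  then have "?q = P" using Q.ord_eq_1[OF q] by (simp add: FactGroup_def)
  moreover have "x \<in> ?q" by (rule K.rcos_self) (use xH N.subgroup_axioms in auto)
  ultimately show ?thesis by simp
qed

lemma sylow_decomposition:
  assumes "finite (carrier G)" "prime p"
  obtains P a k where "subgroup P G" "card P = p ^ a" "order G = p ^ a * k" "\<not> p dvd k"
proof -
  have "order G \<noteq> 0" using assms(1) order_gt_0_iff_finite by simp
  then obtain k where k: "order G = p ^ multiplicity p (order G) * k" "\<not> p dvd k"
    using multiplicity_decompose'[of "order G" p] assms(2) by (metis not_prime_unit)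
  then obtain P where "subgroup P G" "card P = p ^ multiplicity p (order G)"
    using sylow_thm[OF assms(2) is_group k(1) assms(1)] by blast
  then show thesis using that k by blast
qed

text \<open>A case of Frobenius's theorem. A Sylow subgroup \<open>P\<close> acts by conjugation on
  the solutions of \<open>x [^] p = \<one>\<close>. The fixed solutions centralize \<open>P\<close>,
  hence lie in \<open>P\<close>, and form a subgroup of its centre. That subgroup is not trivial,
  since the centre contains an element of order \<open>p\<close>; so \<open>p\<close> divides its
  order.\<close>

theorem prime_dvd_card_torsion:
  assumes "finite (carrier G)" "prime p" "p dvd order G"
  shows "p dvd card {x\<in>carrier G. x [^] p = \<one>}"
proof -
  obtain P a k where P: "subgroup P G" "card P = p ^ a" "order G = p ^ a * k" "\<not> p dvd k"
    using sylow_decomposition[OF assms(1,2)] .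
  interpret P: subgroup P G by fact
  let ?P = "G\<lparr>carrier := P\<rparr>"
  interpret GP: group ?P by (rule subgroup_imp_group[OF P(1)])
  have "0 < a" using P assms(3) by (cases a) auto
  let ?S = "{x\<in>carrier G. x [^] p = \<one>}"
  let ?F = "{x\<in>?S. \<forall>g\<in>P. conj_by G g x = x}"
  interpret A: group_action ?P ?S "\<lambda>g. restrict (conj_by G g) ?S"
    by (rule GP.group_actionI) (auto simp: conj_by_comp conj_by_pow[symmetric] conj_by_def[of G _ \<one>])
  have "finite ?S" using assms(1) by simp
  have cong: "[card ?S = card ?F] (mod p)"
    using A.p_group_fixed_points[OF \<open>finite ?S\<close> assms(2), of a] P(2) by (simp add: order_def cong: conj_cong)
  have dvd: "p dvd card ?F"
  proof -
    have comm: "x \<otimes> g = g \<otimes> x" if "x \<in> ?F" "g \<in> P" for x g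
      using that conj_by_fixed_iff[of g x] by auto
    have FP: "x \<in> P" if "x \<in> ?F" for x
    proof (rule sylow_normalizing_element[OF assms(1,2) P])
      show "x \<in> carrier G" "x [^] (p ^ 1) = \<one>" using that by auto
      have "conj_by G x g = g" if "g \<in> P" for g
        using comm[OF \<open>x \<in> ?F\<close> that] conj_by_fixed_iff[of x g] that \<open>x \<in> carrier G\<close> by auto
      then show "conj_by G x ` P = P" by simp
    qed
    have "subgroup ?F ?P"
    proof (rule GP.subgroupI)
      show "?F \<subseteq> carrier ?P"
      proof
        fix x assume "x \<in> ?F"
        then show "x \<in> carrier ?P" using FP[of x] by simp
      qed
      have "\<one> \<in> ?F" by (auto simp: conj_by_def)
      then show "?F \<noteq> {}" by blast
    next
      fix x y assume xy: "x \<in> ?F" "y \<in> ?F"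
      then have "x \<otimes> y = y \<otimes> x" using comm FP by blast
      then have "(x \<otimes> y) [^] p = \<one>" using xy by (simp add: pow_mult_distrib)
      then show "x \<otimes>\<^bsub>?P\<^esub> y \<in> ?F" using xy by (simp add: conj_by_mult)
    next
      fix x assume x: "x \<in> ?F"
      then have "conj_by G g (inv x) = inv x" if "g \<in> P" for g
        using group_hom.hom_inv[OF conj_by_group_hom, of g x] that by auto
      then show "inv\<^bsub>?P\<^esub> x \<in> ?F"
        using x FP[OF x] P(1) by (simp add: m_inv_consistent nat_pow_inv)
    qed
    then have "card ?F dvd order ?P" by (rule GP.card_subgroup_dvd_order)
    then have "card ?F dvd p ^ a" using P(2) by (simp add: order_def)
    moreover have "card ?F \<noteq> 1"
    proof -
      obtain z where z: "z \<in> P" "z \<noteq> \<one>" "z [^]\<^bsub>?P\<^esub> p = \<one>" "\<And>g. g \<in> P \<Longrightarrow> conj_by ?P g z = z"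
        using GP.p_group_central_element[OF assms(2), of a] P(2) \<open>0 < a\<close> by (auto simp: order_def)
      have "conj_by G g z = z" if "g \<in> P" for g
        using z(4)[OF that] that P(1) by (simp add: conj_by_def m_inv_consistent)
      then have zF: "z \<in> ?F" using z by (auto simp: nat_pow_consistent[symmetric])
      have oneF: "\<one> \<in> ?F" by (auto simp: conj_by_def)
      show ?thesis
      proof
        assume "card ?F = 1"
        then obtain w where w: "?F = {w}" by (rule card_1_singletonE)
        show False using zF oneF z(2) unfolding w by simp
      qed
    qed
    ultimately show ?thesis by (rule prime_dvd_if_dvd_prime_power[OF assms(2)])
  qed
  show ?thesis by (rule iffD2[OF cong_dvd_iff[OF cong] dvd])
qed

end

section \<open>Conjugacy classes of cyclic subgroups\<close>

text \<open>Members of \<open>Bij S\<close> are undefined outside \<open>S\<close>, where a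
  permutation of \<open>S\<close> is the identity. Exchanging the two conventions is the
  bijection.\<close>

lemma card_Bij:
  assumes "finite S"
  shows "card (Bij S) = fact (card S)"
proof -
  have "bij_betw (\<lambda>p. restrict p S) {p. p permutes S} (Bij S)"
  proof (rule bij_betw_byWitness[of _ "\<lambda>f x. if x \<in> S then f x else x"])
    show "\<forall>p\<in>{p. p permutes S}. (\<lambda>x. if x \<in> S then restrict p S x else x) = p"
      by (auto simp: permutes_def fun_eq_iff)
    show "\<forall>f\<in>Bij S. restrict (\<lambda>x. if x \<in> S then f x else x) S = f"
      by (auto simp: Bij_def fun_eq_iff restrict_def extensional_def)
    show "(\<lambda>p. restrict p S) ` {p. p permutes S} \<subseteq> Bij S"
      using permutes_imp_bij by (fastforce simp: Bij_def cong: bij_betw_cong)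
    show "(\<lambda>f x. if x \<in> S then f x else x) ` Bij S \<subseteq> {p. p permutes S}"
    proof clarify
      fix f assume "f \<in> Bij S"
      then have "bij_betw (\<lambda>x. if x \<in> S then f x else x) S S"
        by (auto simp: Bij_def cong: bij_betw_cong)
      then show "(\<lambda>x. if x \<in> S then f x else x) permutes S"
        by (intro bij_imp_permutes) auto
    qed
  qed
  then show ?thesis
    using card_permutations[OF refl assms] by (simp add: bij_betw_same_card)
qed

text \<open>The kernel is normal and proper, as \<open>g\<close> moves \<open>x\<close>; hence it is
  trivial and \<open>G\<close> embeds into the symmetric group on \<open>S\<close>.\<close>

lemma (in simple_group) order_dvd_fact_if_acts:
  assumes "group_action G S \<phi>" "finite S" "x \<in> S" "g \<in> carrier G" "\<phi> g x \<noteq> x"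
  shows "order G dvd fact (card S)"
proof -
  interpret A: group_action G S \<phi> by fact
  interpret h: group_hom G "BijGroup S" \<phi> by (rule A.group_hom)
  have "kernel G (BijGroup S) \<phi> \<noteq> carrier G"
  proof
    assume "kernel G (BijGroup S) \<phi> = carrier G"
    then have "\<phi> g = (\<lambda>x\<in>S. x)" using assms(4) by (auto simp: kernel_def BijGroup_def)
    then show False using assms(3,5) by simp
  qed
  then have "kernel G (BijGroup S) \<phi> = {\<one>}" using no_real_normal_subgroup[OF h.normal_kernel] by blast
  then have "inj_on \<phi> (carrier G)" by (rule h.trivial_ker_imp_inj)
  then have "card (\<phi> ` carrier G) = order G" by (simp add: card_image order_def)
  moreover have "card (\<phi> ` carrier G) dvd order (BijGroup S)"
    using group.lagrange[OF group_BijGroup h.img_is_subgroup] by (metis dvd_triv_right)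
  moreover have "order (BijGroup S) = fact (card S)"
    using card_Bij[OF assms(2)] by (simp add: order_def BijGroup_def)
  ultimately show ?thesis by simp
qed

context group
begin

lemma card_generators:
  assumes fin: "finite (carrier G)" and x: "x \<in> carrier G"
  shows "card {y \<in> carrier G. generate G {y} = generate G {x}} = totient (ord x)"
proof -
  have sub: "generate G {y} \<subseteq> generate G {x}" if "y \<in> generate G {x}" for y
    using generate_subgroup_incl[of "{y}" "generate G {x}"] generate_is_subgroup[of "{x}"] that x by simp
  have fing: "finite (generate G {x})"
    using finite_subset[OF generate_incl fin] x by simp
  have card: "card (generate G {y}) = ord y" if "y \<in> carrier G" for y using generate_pow_card that by simp
  \<comment> \<open>The exponents run from 1 to \<open>ord x\<close>, not from 0, to match
    \<open>totatives\<close>.\<close>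
  have inj: "inj_on (\<lambda>k. x [^] k) {0<..ord x}"
    using ord_inj'[OF x] by (rule inj_on_subset) auto
  have pow: "x [^] (k::nat) \<in> generate G {x}" for k
    using generate_pow_on_finite_carrier[OF fin x] by blast
  have img: "(\<lambda>k. x [^] k) ` {0<..ord x} = generate G {x}"
    using pow card[OF x] by (intro card_subset_eq fing) (auto simp: card_image[OF inj])
  have gen: "generate G {x [^] k} = generate G {x} \<longleftrightarrow> coprime k (ord x)" for k :: nat
  proof -
    have "generate G {x [^] k} = generate G {x} \<longleftrightarrow> ord (x [^] k) = ord x"
      using card_subset_eq[OF fing sub[OF pow[of k]]] card[of "x [^] k"] card[OF x] x by auto
    then show ?thesis using pow_ord_eq_ord_iff[OF fin x] by blast
  qed
  have "{y \<in> carrier G. generate G {y} = generate G {x}} = (\<lambda>k. x [^] k) ` totatives (ord x)"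
  proof (intro equalityI subsetI)
    fix y assume y: "y \<in> {y \<in> carrier G. generate G {y} = generate G {x}}"
    then have "y \<in> generate G {x}" using generate.incl[of y "{y}" G] by auto
    then obtain k where "k \<in> {0<..ord x}" "y = x [^] k" using img by blast
    then show "y \<in> (\<lambda>k. x [^] k) ` totatives (ord x)" using y gen by (auto simp: totatives_def)
  qed (use x gen in \<open>auto simp: totatives_def\<close>)
  then show ?thesis
    using inj_on_subset[OF inj, of "totatives (ord x)"] by (simp add: card_image totient_def totatives_def subset_iff)
qed

lemma finite_cyclic_subgroups: "finite (carrier G) \<Longrightarrow> finite (cyclic_subgroups G)"
  by (simp add: cyclic_subgroups_eq_generate)

text \<open>Elements are grouped by the subgroup that they generate. The predicate \<open>Q\<close>
  lets one identity count all elements, those of order 1 or \<open>p\<close>, and those of order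
  dividing \<open>p ^ a\<close>.\<close>

lemma card_ord_eq_sum_totient:
  assumes fin: "finite (carrier G)"
  shows "card {y \<in> carrier G. Q (ord y)} = (\<Sum>C | C \<in> cyclic_subgroups G \<and> Q (card C). totient (card C))"
proof -
  have card: "card (generate G {y}) = ord y" if "y \<in> carrier G" for y using generate_pow_card that by simp
  let ?S = "{y \<in> carrier G. Q (ord y)}" and ?T = "{C \<in> cyclic_subgroups G. Q (card C)}"
  have "(\<Sum>C\<in>?T. \<Sum>y\<in>{y\<in>?S. generate G {y} = C}. 1::nat) = (\<Sum>y\<in>?S. 1::nat)"
    using fin finite_cyclic_subgroups[OF fin] card
    by (intro sum.group) (auto simp: cyclic_subgroups_eq_generate)
  moreover have "(\<Sum>y\<in>{y\<in>?S. generate G {y} = C}. 1::nat) = totient (card C)" if C: "C \<in> ?T" for C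
  proof -
    obtain x where x: "x \<in> carrier G" "C = generate G {x}"
      using C by (auto simp: cyclic_subgroups_eq_generate)
    have "{y\<in>?S. generate G {y} = C} = {y \<in> carrier G. generate G {y} = generate G {x}}"
      using C x card by fastforce
    then show ?thesis using card_generators[OF fin x(1)] card[OF x(1)] x(2) by simp
  qed
  ultimately show ?thesis by simp
qed

end

section \<open>Conjugation of nontrivial cyclic subgroups\<close>

definition nontrivial_cyclic :: "('a, 'b) monoid_scheme \<Rightarrow> 'a set set" where
  "nontrivial_cyclic G = cyclic_subgroups G - {{\<one>\<^bsub>G\<^esub>}}"

definition conj_class :: "('a, 'b) monoid_scheme \<Rightarrow> 'a set \<Rightarrow> 'a set set" where
  "conj_class G H = (\<lambda>g. conj_by G g ` H) ` carrier G"

text \<open>For a subgroup \<open>H\<close> this is its normalizer, stated with images under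
  \<open>conj_by\<close> rather than with cosets.\<close>

definition conj_stab :: "('a, 'b) monoid_scheme \<Rightarrow> 'a set \<Rightarrow> 'a set" where
  "conj_stab G H = {g \<in> carrier G. conj_by G g ` H = H}"

context group
begin

lemma nontrivial_cyclicE:
  assumes "C \<in> nontrivial_cyclic G"
  obtains x where "x \<in> carrier G" "x \<noteq> \<one>" "C = generate G {x}" "card C = ord x"
proof -
  obtain x where x: "x \<in> carrier G" "C = generate G {x}" "C \<noteq> {\<one>}"
    using assms by (auto simp: nontrivial_cyclic_def cyclic_subgroups_eq_generate)
  then have "x \<noteq> \<one>" using generate_one by auto
  then show thesis using that x generate_pow_card by simp
qed

lemma generate_nontrivial_cyclic:
  assumes "x \<in> carrier G" "x \<noteq> \<one>"
  shows "generate G {x} \<in> nontrivial_cyclic G"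
  using assms generate.incl[of x "{x}" G] by (auto simp: nontrivial_cyclic_def cyclic_subgroups_eq_generate)

lemma nontrivial_cyclic_subgroup: "C \<in> nontrivial_cyclic G \<Longrightarrow> subgroup C G"
  by (simp add: nontrivial_cyclic_def cyclic_subgroups_def)

lemma conj_by_image_nontrivial_cyclic:
  assumes "g \<in> carrier G" "C \<in> nontrivial_cyclic G"
  shows "conj_by G g ` C \<in> nontrivial_cyclic G"
proof -
  obtain x where x: "x \<in> carrier G" "x \<noteq> \<one>" "C = generate G {x}"
    using nontrivial_cyclicE[OF assms(2)] by metis
  have "conj_by G g x \<noteq> \<one>"
    using conj_by_eq_iff[OF assms(1) x(1) one_closed] x(2) assms(1) by (auto simp: conj_by_def)
  then show ?thesis
    using generate_nontrivial_cyclic[of "conj_by G g x"] conj_by_image_generate assms(1) x by simp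
qed

lemma conj_action:
  "group_action G (nontrivial_cyclic G) (\<lambda>g. restrict ((`) (conj_by G g)) (nontrivial_cyclic G))"
proof (rule group_actionI)
  have sub: "C \<subseteq> carrier G" if "C \<in> nontrivial_cyclic G" for C
    using nontrivial_cyclic_subgroup[OF that] subgroup.subset by blast
  show "conj_by G \<one> ` C = C" if "C \<in> nontrivial_cyclic G" for C
    by (rule conj_by_one_image[OF sub[OF that]])
  show "conj_by G (g \<otimes> h) ` C = conj_by G g ` conj_by G h ` C"
    if "g \<in> carrier G" "h \<in> carrier G" "C \<in> nontrivial_cyclic G" for g h C
    by (rule conj_by_image_comp[OF that(1,2) sub[OF that(3)]])
qed (rule conj_by_image_nontrivial_cyclic)

lemma orbit_eq_conj_class:
  "C \<in> nontrivial_cyclic G \<Longrightarrow> orbit G (\<lambda>g. restrict ((`) (conj_by G g)) (nontrivial_cyclic G)) C = conj_class G C"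
  by (auto simp: orbit_def conj_class_def)

lemma conj_stab_subgroup: "C \<in> nontrivial_cyclic G \<Longrightarrow> subgroup (conj_stab G C) G"
  using group_action.stabilizer_subgroup[OF conj_action, of C]
  by (simp add: stabilizer_def conj_stab_def cong: conj_cong)

lemma card_conj_class_mult:
  "C \<in> nontrivial_cyclic G \<Longrightarrow> card (conj_class G C) * card (conj_stab G C) = order G"
  using group_action.orbit_stabilizer_theorem[OF conj_action, of C]
  by (simp add: orbit_eq_conj_class stabilizer_def conj_stab_def cong: conj_cong)

lemma card_conj_image: "g \<in> carrier G \<Longrightarrow> H \<subseteq> carrier G \<Longrightarrow> card (conj_by G g ` H) = card H"
  using inj_on_conj_by by (rule card_image)

lemma subgroup_conj_stab:
  assumes "finite (carrier G)" "subgroup C G"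
  shows "C \<subseteq> conj_stab G C"
proof
  fix g assume g: "g \<in> C"
  interpret C: subgroup C G by fact
  have "conj_by G g ` C \<subseteq> C" using g by (auto simp: conj_by_def)
  then have "conj_by G g ` C = C"
    using card_conj_image[of g C] g C.subset finite_subset[OF C.subset assms(1)] by (intro card_subset_eq) auto
  then show "g \<in> conj_stab G C" using g by (simp add: conj_stab_def)
qed

lemma self_in_conj_class: "subgroup C G \<Longrightarrow> C \<in> conj_class G C"
proof -
  assume "subgroup C G"
  then have "C \<subseteq> carrier G" by (rule subgroup.subset)
  then have "conj_by G \<one> ` C = C" by (rule conj_by_one_image)
  then show ?thesis unfolding conj_class_def by (metis imageI one_closed)
qed

lemma card_conj_class_gt_0: "finite (carrier G) \<Longrightarrow> subgroup C G \<Longrightarrow> 0 < card (conj_class G C)"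
  using self_in_conj_class by (subst card_gt_0_iff) (auto simp: conj_class_def)

lemma subgroup_card_dvd:
  assumes "subgroup H G" "subgroup K G" "H \<subseteq> K"
  shows "card H dvd card K"
proof -
  have "card H dvd order (G\<lparr>carrier := K\<rparr>)"
    by (rule group.card_subgroup_dvd_order[OF subgroup_imp_group[OF assms(2)] subgroup_incl[OF assms]])
  then show ?thesis by (simp add: order_def)
qed

end

section \<open>The pairs of order and size in a finite nonabelian simple group\<close>

locale finite_nonabelian_simple_group = simple_group +
  assumes finite_carrier: "finite (carrier G)"
    and nonabelian: "\<not> comm_group G"
begin

text \<open>\<open>SOME\<close> picks a representative; conjugate subgroups have equal order, so the
  choice does not matter.\<close>

definition class_data :: "(nat \<times> nat) multiset" where
  "class_data = image_mset (\<lambda>\<Omega>. (card (SOME C. C \<in> \<Omega>), card \<Omega>)) (mset_set (conj_class G ` nontrivial_cyclic G))"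

lemma finite_nontrivial_cyclic: "finite (nontrivial_cyclic G)"
  using finite_cyclic_subgroups[OF finite_carrier] by (simp add: nontrivial_cyclic_def)

lemma card_some_conj_class:
  assumes "C \<in> nontrivial_cyclic G"
  shows "card (SOME D. D \<in> conj_class G C) = card C"
proof -
  have "C \<in> conj_class G C" using assms nontrivial_cyclic_subgroup self_in_conj_class by blast
  then have "(SOME D. D \<in> conj_class G C) \<in> conj_class G C" by (rule someI)
  then show ?thesis
    using card_conj_image subgroup.subset[OF nontrivial_cyclic_subgroup[OF assms]]
    by (auto simp: conj_class_def)
qed

lemma in_class_data_iff:
  "(m, s) \<in># class_data \<longleftrightarrow> (\<exists>C\<in>nontrivial_cyclic G. m = card C \<and> s = card (conj_class G C))"
  using finite_nontrivial_cyclic by (auto simp: class_data_def card_some_conj_class image_iff)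

lemma class_dataE:
  assumes "(m, s) \<in># class_data"
  obtains C where "C \<in> nontrivial_cyclic G" "m = card C" "s = card (conj_class G C)"
  using assms in_class_data_iff by blast

lemma class_dataI: "C \<in> nontrivial_cyclic G \<Longrightarrow> (card C, card (conj_class G C)) \<in># class_data"
  using in_class_data_iff by blast

text \<open>The classes are the orbits of conjugation, and the order is constant on each. With
  \<open>f\<close> constantly 1 this counts subgroups, with the totient it counts elements.\<close>

lemma sum_class_data:
  "(\<Sum>x\<in>#class_data. snd x * f (fst x)) = (\<Sum>C\<in>nontrivial_cyclic G. f (card C))"
proof -
  interpret A: group_action G "nontrivial_cyclic G"
    "\<lambda>g. restrict ((`) (conj_by G g)) (nontrivial_cyclic G)" by (rule conj_action)
  have orbits: "orbits G (nontrivial_cyclic G) (\<lambda>g. restrict ((`) (conj_by G g)) (nontrivial_cyclic G))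
      = conj_class G ` nontrivial_cyclic G"
    by (auto simp: orbits_def orbit_eq_conj_class image_iff intro!: exI)
  have inner: "(\<Sum>D\<in>\<Omega>. f (card D)) = card \<Omega> * f (card (SOME C. C \<in> \<Omega>))"
    if om: "\<Omega> \<in> conj_class G ` nontrivial_cyclic G" for \<Omega>
  proof -
    obtain C where C: "C \<in> nontrivial_cyclic G" "\<Omega> = conj_class G C" using om by blast
    have "card D = card C" if "D \<in> \<Omega>" for D
      using that card_conj_image subgroup.subset[OF nontrivial_cyclic_subgroup[OF C(1)]]
      by (auto simp: conj_class_def C(2))
    then have "(\<Sum>D\<in>\<Omega>. f (card D)) = (\<Sum>D\<in>\<Omega>. f (card C))" by (intro sum.cong) auto
    then show ?thesis using card_some_conj_class[OF C(1)] C(2) by simp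
  qed
  have "(\<Sum>x\<in>#class_data. snd x * f (fst x))
      = (\<Sum>\<Omega>\<in>conj_class G ` nontrivial_cyclic G. card \<Omega> * f (card (SOME C. C \<in> \<Omega>)))"
    by (simp add: class_data_def image_mset.compositionality comp_def sum_unfold_sum_mset)
  also have "\<dots> = (\<Sum>\<Omega>\<in>conj_class G ` nontrivial_cyclic G. \<Sum>D\<in>\<Omega>. f (card D))"
    using inner by (intro sum.cong) auto
  also have "\<dots> = (\<Sum>C\<in>nontrivial_cyclic G. f (card C))"
    using A.disjoint_sum[OF finite_nontrivial_cyclic] orbits by simp
  finally show ?thesis .
qed

text \<open>The summand 1 is the identity, which generates the trivial subgroup and so belongs to no
  class; \<open>Q 1\<close> puts it into the set counted.\<close>

lemma card_ord_eq_sum_class_data: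
  assumes "Q 1"
  shows "card {x \<in> carrier G. Q (ord x)}
    = 1 + (\<Sum>x\<in>#class_data. if Q (fst x) then snd x * totient (fst x) else 0)"
proof -
  let ?T = "{C. C \<in> cyclic_subgroups G \<and> Q (card C)}"
  have fin: "finite ?T" using finite_cyclic_subgroups[OF finite_carrier] by simp
  have "{\<one>} \<in> cyclic_subgroups G"
    unfolding cyclic_subgroups_eq_generate using generate_one by (metis imageI one_closed)
  then have "{\<one>} \<in> ?T" using assms by simp
  then have "card {x \<in> carrier G. Q (ord x)} = 1 + (\<Sum>C\<in>?T - {{\<one>}}. totient (card C))"
    unfolding card_ord_eq_sum_totient[OF finite_carrier, of Q] using fin by (subst sum.remove) auto
  also have "(\<Sum>C\<in>?T - {{\<one>}}. totient (card C))
      = (\<Sum>C\<in>nontrivial_cyclic G. if Q (card C) then totient (card C) else 0)"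
    using finite_nontrivial_cyclic
    by (subst sum.inter_filter[symmetric]) (auto simp: nontrivial_cyclic_def intro!: sum.cong)
  also have "\<dots> = (\<Sum>x\<in>#class_data. snd x * (if Q (fst x) then totient (fst x) else 0))"
    by (rule sum_class_data[symmetric])
  also have "\<dots> = (\<Sum>x\<in>#class_data. if Q (fst x) then snd x * totient (fst x) else 0)"
    by (intro arg_cong[of _ _ sum_mset] image_mset_cong) auto
  finally show ?thesis .
qed

lemma order_eq_class_data: "order G = 1 + (\<Sum>x\<in>#class_data. snd x * totient (fst x))"
  using card_ord_eq_sum_class_data[of "\<lambda>_. True"] by (simp add: order_def)

lemma sum_sizes_class_data: "1 + (\<Sum>x\<in>#class_data. snd x) = num_cyclic_subgroups G"
proof -
  have "{\<one>} \<in> cyclic_subgroups G"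
    unfolding cyclic_subgroups_eq_generate using generate_one by (metis imageI one_closed)
  then have "num_cyclic_subgroups G = 1 + card (nontrivial_cyclic G)"
    using finite_cyclic_subgroups[OF finite_carrier] card_Suc_Diff1
    by (metis num_cyclic_subgroups_def nontrivial_cyclic_def plus_1_eq_Suc)
  then show ?thesis using sum_class_data[of "\<lambda>_. 1"] by simp
qed

text \<open>A class with one member would be a nontrivial normal subgroup, hence the whole group,
  which would then be cyclic and abelian.\<close>

lemma card_conj_class_ge_2:
  assumes C: "C \<in> nontrivial_cyclic G"
  shows "2 \<le> card (conj_class G C)"
proof (rule ccontr)
  have sub: "subgroup C G" using nontrivial_cyclic_subgroup[OF C] .
  assume "\<not> 2 \<le> card (conj_class G C)"
  then have "card (conj_class G C) = 1"
    using card_conj_class_gt_0[OF finite_carrier sub] by simp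
  then obtain D where "conj_class G C = {D}" by (rule card_1_singletonE)
  then have eq: "conj_class G C = {C}" using self_in_conj_class[OF sub] by auto
  have "x \<otimes> h \<otimes> inv x \<in> C" if "x \<in> carrier G" "h \<in> C" for x h
  proof -
    have "conj_by G x ` C \<in> conj_class G C" using that(1) by (simp add: conj_class_def)
    then have "conj_by G x ` C = C" using eq by simp
    then show ?thesis using that(2) by (auto simp: conj_by_def)
  qed
  then have "C \<lhd> G" using sub by (simp add: normal_inv_iff)
  then have "C = carrier G" using no_real_normal_subgroup C by (auto simp: nontrivial_cyclic_def)
  then have "cyclic_group G" using C by (simp add: nontrivial_cyclic_def cyclic_subgroups_def)
  then show False using nonabelian cyclic_imp_abelian_group by blast
qed

text \<open>Conjugation is transitive on a class with at least two members, so the action moves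
  something.\<close>

lemma order_dvd_fact_card_conj_class:
  assumes C: "C \<in> nontrivial_cyclic G"
  shows "order G dvd fact (card (conj_class G C))"
proof -
  have sub: "C \<subseteq> carrier G" using subgroup.subset[OF nontrivial_cyclic_subgroup[OF C]] .
  have CC: "C \<in> conj_class G C" by (rule self_in_conj_class[OF nontrivial_cyclic_subgroup[OF C]])
  have "group_action G (conj_class G C) (\<lambda>g. restrict ((`) (conj_by G g)) (conj_class G C))"
  proof (rule group_actionI)
    fix g D assume g: "g \<in> carrier G" and "D \<in> conj_class G C"
    then obtain h where h: "h \<in> carrier G" "D = conj_by G h ` C" by (auto simp: conj_class_def)
    show "conj_by G g ` D \<in> conj_class G C"
      unfolding h(2) conj_by_image_comp[OF g h(1) sub, symmetric] conj_class_def
      using g h(1) by blast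
  next
    fix D assume "D \<in> conj_class G C"
    then have "D \<subseteq> carrier G" using sub by (auto simp: conj_class_def)
    then show "conj_by G \<one> ` D = D" by (rule conj_by_one_image)
  next
    fix g h D assume gh: "g \<in> carrier G" "h \<in> carrier G" and "D \<in> conj_class G C"
    then have "D \<subseteq> carrier G" using sub by (auto simp: conj_class_def)
    then show "conj_by G (g \<otimes> h) ` D = conj_by G g ` conj_by G h ` D" by (rule conj_by_image_comp[OF gh])
  qed
  moreover have "finite (conj_class G C)" using finite_carrier by (simp add: conj_class_def)
  moreover obtain g where "g \<in> carrier G" "conj_by G g ` C \<noteq> C"
  proof -
    have "conj_class G C \<noteq> {C}" using card_conj_class_ge_2[OF C] by auto
    then show thesis using that CC by (auto simp: conj_class_def)
  qed
  ultimately show ?thesis using order_dvd_fact_if_acts CC by (metis restrict_apply')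
qed

lemma card_nontrivial_cyclic_ge_2:
  assumes "C \<in> nontrivial_cyclic G"
  shows "2 \<le> card C"
proof -
  obtain x where x: "x \<in> carrier G" "x \<noteq> \<one>" "card C = ord x" using nontrivial_cyclicE[OF assms] by metis
  then have "ord x \<noteq> 1" using ord_eq_1 by blast
  then show ?thesis using ord_ge_1[OF finite_carrier x(1)] x(3) by simp
qed

text \<open>If \<open>g\<close> conjugates the generator \<open>x\<close> to a power of
  \<open>x\<close>, it conjugates \<open>y\<close>, itself a power of \<open>x\<close>, to the same
  power of \<open>y\<close>. So the normalizer of \<open>C\<close> lies in that of the subgroup of
  order \<open>d\<close>, and the index of the latter divides that of the former.\<close>

lemma divisor_class:
  assumes C: "C \<in> nontrivial_cyclic G" and d: "d dvd card C" "2 \<le> d"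
  shows "\<exists>D\<in>nontrivial_cyclic G. card D = d \<and> card (conj_class G D) dvd card (conj_class G C)"
proof -
  obtain x where x: "x \<in> carrier G" "C = generate G {x}" "card C = ord x" using nontrivial_cyclicE[OF C] by metis
  obtain k where k: "ord x = d * k" using d(1) x(3) by auto
  have "ord x \<noteq> 0" using ord_ge_1[OF finite_carrier x(1)] by simp
  then have "k \<noteq> 0" using k by auto
  define y where "y = x [^] k"
  have y: "y \<in> carrier G" using x by (simp add: y_def)
  have ordy: "ord y = d" unfolding y_def using ord_pow[OF x(1), of k] k \<open>k \<noteq> 0\<close> by simp
  then have "y \<noteq> \<one>" using d(2) by auto
  let ?D = "generate G {y}"
  have D: "?D \<in> nontrivial_cyclic G" using generate_nontrivial_cyclic[OF y \<open>y \<noteq> \<one>\<close>] .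
  have cardD: "card ?D = d" using generate_pow_card[OF y] ordy by simp
  have "conj_stab G C \<subseteq> conj_stab G ?D"
  proof
    fix g assume "g \<in> conj_stab G C"
    then have g: "g \<in> carrier G" "conj_by G g ` C = C" by (auto simp: conj_stab_def)
    have "x \<in> C" using generate.incl[of x "{x}" G] x(2) by simp
    then have "conj_by G g x \<in> C" using g(2) by blast
    then obtain j where j: "conj_by G g x = x [^] (j::nat)"
      using generate_pow_on_finite_carrier[OF finite_carrier x(1)] x(2) by auto
    have "conj_by G g y = y [^] j"
      using g(1) x(1) j by (simp add: y_def conj_by_pow nat_pow_pow mult.commute)
    then have "conj_by G g y \<in> ?D"
      using generate_pow_on_finite_carrier[OF finite_carrier y] by auto
    then have "generate G {conj_by G g y} \<subseteq> ?D"
      using generate_subgroup_incl[of "{conj_by G g y}" ?D] nontrivial_cyclic_subgroup[OF D] by simp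
    then have "conj_by G g ` ?D \<subseteq> ?D" using conj_by_image_generate[OF g(1) y] by simp
    moreover have "card (conj_by G g ` ?D) = card ?D"
      using card_conj_image[OF g(1)] subgroup.subset[OF nontrivial_cyclic_subgroup[OF D]] by blast
    moreover have "finite ?D"
      using finite_subset[OF subgroup.subset[OF nontrivial_cyclic_subgroup[OF D]] finite_carrier] .
    ultimately have "conj_by G g ` ?D = ?D" by (intro card_subset_eq) auto
    then show "g \<in> conj_stab G ?D" using g(1) by (simp add: conj_stab_def)
  qed
  then have "card (conj_stab G C) dvd card (conj_stab G ?D)"
    by (intro subgroup_card_dvd conj_stab_subgroup C D)
  then obtain e where e: "card (conj_stab G ?D) = card (conj_stab G C) * e" by auto
  have "card (conj_class G C) * card (conj_stab G C) = card (conj_class G ?D) * e * card (conj_stab G C)"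
    using card_conj_class_mult[OF C] card_conj_class_mult[OF D] e by (simp add: ac_simps)
  moreover have "card (conj_stab G C) \<noteq> 0"
  proof
    assume "card (conj_stab G C) = 0"
    then have "order G = 0" using card_conj_class_mult[OF C] by simp
    then show False using order_gt_one by simp
  qed
  ultimately have "card (conj_class G C) = card (conj_class G ?D) * e" by simp
  then show ?thesis using D cardD by auto
qed

text \<open>If there are \<open>u\<close> subgroups of order \<open>p\<close>, the solutions of
  \<open>x [^] p = \<one>\<close> number 1 + u(p - 1), which \<open>p\<close> divides and which is 1
  - u modulo \<open>p\<close>.\<close>

lemma prime_cong_class_data:
  assumes "prime p" "p dvd order G"
  shows "[(\<Sum>x\<in>#class_data. if fst x = p then snd x else 0) = 1] (mod p)"
proof -
  let ?u = "\<Sum>x\<in>#class_data. if fst x = p then snd x else 0"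
  have "d dvd p \<longleftrightarrow> d = 1 \<or> d = p" for d
    using assms(1) unfolding prime_nat_iff by (metis dvd_refl one_dvd)
  then have "x [^] p = \<one> \<longleftrightarrow> ord x = 1 \<or> ord x = p" if "x \<in> carrier G" for x
    using pow_eq_id[OF that] by simp
  then have "{x \<in> carrier G. x [^] p = \<one>} = {x \<in> carrier G. ord x = 1 \<or> ord x = p}"
    by (intro Collect_cong) blast
  then have "card {x \<in> carrier G. x [^] p = \<one>} = 1 +
      (\<Sum>x\<in>#class_data. if fst x = 1 \<or> fst x = p then snd x * totient (fst x) else 0)"
    using card_ord_eq_sum_class_data[of "\<lambda>k. k = 1 \<or> k = p"] by simp
  also have "(\<Sum>x\<in>#class_data. if fst x = 1 \<or> fst x = p then snd x * totient (fst x) else 0)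
      = (\<Sum>x\<in>#class_data. (if fst x = p then snd x else 0) * (p - 1))"
  proof (intro arg_cong[of _ _ sum_mset] image_mset_cong)
    fix x assume "x \<in># class_data"
    then have "2 \<le> fst x" using in_class_data_iff[of "fst x" "snd x"] card_nontrivial_cyclic_ge_2 by auto
    then show "(if fst x = 1 \<or> fst x = p then snd x * totient (fst x) else 0)
      = (if fst x = p then snd x else 0) * (p - 1)"
      using totient_prime[OF assms(1)] by auto
  qed
  also have "\<dots> = ?u * (p - 1)" by (simp add: sum_mset_distrib_right)
  finally have "p dvd 1 + ?u * (p - 1)"
    using prime_dvd_card_torsion[OF finite_carrier assms] by simp
  \<comment> \<open>Adding \<open>?u\<close> to both sides turns the count into
    \<open>1 + ?u * p\<close> without subtracting natural numbers.\<close>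
  then have "[1 + ?u * (p - 1) + ?u = 0 + ?u] (mod p)" by (intro cong_add) (simp_all add: cong_0_iff)
  moreover have "1 + ?u * (p - 1) + ?u = 1 + ?u * p"
    using prime_gt_0_nat[OF assms(1)] by (simp add: diff_mult_distrib2)
  ultimately have "[1 + ?u * p = ?u] (mod p)" by simp
  moreover have "[1 + ?u * p = 1 + 0] (mod p)" by (intro cong_add cong_refl) (simp add: cong_0_iff)
  then have "[1 + ?u * p = 1] (mod p)" by simp
  ultimately show ?thesis using cong_sym cong_trans by blast
qed


text \<open>A subgroup of order \<open>p\<close> is here a Sylow subgroup, so it normalizes no conjugate but itself.\<close>

lemma sylow_prime_cong:
  assumes p: "prime p" "\<not> p\<^sup>2 dvd order G" and C: "C \<in> nontrivial_cyclic G" "card C = p"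
  shows "[card (conj_class G C) = 1] (mod p)"
proof -
  have sub: "subgroup C G" using nontrivial_cyclic_subgroup[OF C(1)] .
  interpret C: subgroup C G by (rule sub)
  let ?C = "G\<lparr>carrier := C\<rparr>"
  interpret GC: group ?C by (rule subgroup_imp_group[OF sub])
  obtain k where k: "order G = p ^ 1 * k"
    using card_subgroup_dvd_order[OF sub] C(2) by auto
  have "\<not> p dvd k"
  proof
    assume "p dvd k"
    then have "p * p dvd order G" unfolding k power_one_right by (rule mult_dvd_mono[OF dvd_refl])
    then show False using p(2) by (simp add: power2_eq_square)
  qed
  have sub_D: "subgroup D G" "card D = p ^ 1" "D \<subseteq> carrier G" if "D \<in> conj_class G C" for D
  proof -
    obtain h where h: "h \<in> carrier G" "D = conj_by G h ` C" using \<open>D \<in> conj_class G C\<close> by (auto simp: conj_class_def)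
    show "subgroup D G"
      using nontrivial_cyclic_subgroup[OF conj_by_image_nontrivial_cyclic[OF h(1) C(1)]] h(2) by simp
    then show "D \<subseteq> carrier G" by (rule subgroup.subset)
    show "card D = p ^ 1" using card_conj_image[OF h(1) C.subset] h(2) C(2) by simp
  qed
  let ?f = "\<lambda>g. restrict ((`) (conj_by G g)) (conj_class G C)"
  interpret A: group_action ?C "conj_class G C" ?f
  proof (rule GC.group_actionI)
    fix g D assume g: "g \<in> carrier ?C" and "D \<in> conj_class G C"
    then obtain h where h: "h \<in> carrier G" "D = conj_by G h ` C" by (auto simp: conj_class_def)
    have g: "g \<in> carrier G" using g by simp
    show "conj_by G g ` D \<in> conj_class G C"
      unfolding h(2) conj_by_image_comp[OF g h(1) C.subset, symmetric] conj_class_def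
      using g h(1) by blast
  next
    fix D assume "D \<in> conj_class G C"
    then show "conj_by G \<one>\<^bsub>?C\<^esub> ` D = D" using conj_by_one_image[OF sub_D(3)] by simp
  next
    fix g h D assume "g \<in> carrier ?C" "h \<in> carrier ?C" "D \<in> conj_class G C"
    then show "conj_by G (g \<otimes>\<^bsub>?C\<^esub> h) ` D = conj_by G g ` conj_by G h ` D"
      using conj_by_image_comp[of g h D] sub_D(3)[of D] by simp
  qed
  have "finite (conj_class G C)" using finite_carrier by (simp add: conj_class_def)
  moreover have "order ?C = p ^ 1" using C(2) by (simp add: order_def)
  ultimately have "[card (conj_class G C) = card {D \<in> conj_class G C. \<forall>g\<in>carrier ?C. ?f g D = D}] (mod p)"
    using p(1) by (intro A.p_group_fixed_points)
  moreover have "{D \<in> conj_class G C. \<forall>g\<in>carrier ?C. ?f g D = D} = {C}"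
  proof (intro equalityI subsetI)
    fix D assume D: "D \<in> {D \<in> conj_class G C. \<forall>g\<in>carrier ?C. ?f g D = D}"
    then have D': "D \<in> conj_class G C" by simp
    have stable: "conj_by G x ` D = D" if "x \<in> C" for x using D D' that by simp
    have "x \<in> D" if x: "x \<in> C" for x
    proof (rule sylow_normalizing_element[OF finite_carrier p(1) sub_D(1,2)[OF D'] k \<open>\<not> p dvd k\<close> _ stable[OF x]])
      show "x \<in> carrier G" using x by simp
      have "x [^]\<^bsub>?C\<^esub> order ?C = \<one>\<^bsub>?C\<^esub>" using x by (intro GC.pow_order_eq_1) simp
      then show "x [^] (p ^ 1) = \<one>" using C(2) by (simp add: order_def nat_pow_consistent[symmetric])
    qed
    then have "C \<subseteq> D" by blast
    moreover have "finite D" using finite_subset[OF sub_D(3)[OF D'] finite_carrier] .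
    ultimately have "C = D" using sub_D(2)[OF D'] C(2) by (intro card_subset_eq) simp_all
    then show "D \<in> {C}" by simp
  next
    fix D assume "D \<in> {C}"
    then show "D \<in> {D \<in> conj_class G C. \<forall>g\<in>carrier ?C. ?f g D = D}"
      using self_in_conj_class[OF sub] subgroup_conj_stab[OF finite_carrier sub] by (auto simp: conj_stab_def)
  qed
  ultimately show ?thesis by simp
qed

text \<open>If \<open>p\<close> divides the order of the centralizer of an involution \<open>t\<close>, then \<open>t\<close> times
  a centralizing element of order \<open>p\<close> generates a subgroup of order \<open>2 p\<close>.\<close>

lemma involution_class:
  assumes C: "C \<in> nontrivial_cyclic G" "card C = 2" and p: "prime p" "p \<noteq> 2"
    and dvd: "p * card (conj_class G C) dvd order G"
  shows "\<exists>D\<in>nontrivial_cyclic G. card D = 2 * p"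
proof -
  obtain t where t: "t \<in> carrier G" "t \<noteq> \<one>" "C = generate G {t}" "ord t = 2"
    using nontrivial_cyclicE[OF C(1)] C(2) by metis
  have "t \<in> C" "\<one> \<in> C" using t(3) generate.incl[of t "{t}" G] generate.one by auto
  moreover obtain a b where "C = {a, b}" using C(2) by (auto simp: card_2_iff)
  ultimately have C_eq: "C = {\<one>, t}" using t(2) by auto
  have sub: "subgroup (conj_stab G C) G" using conj_stab_subgroup[OF C(1)] .
  have "card (conj_class G C) > 0"
    using card_conj_class_gt_0[OF finite_carrier nontrivial_cyclic_subgroup[OF C(1)]] .
  then have "p dvd card (conj_stab G C)"
    using dvd card_conj_class_mult[OF C(1)] by (metis mult.commute nat_mult_dvd_cancel1)
  then obtain k where k: "card (conj_stab G C) = p ^ 1 * k" by auto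
  let ?H = "G\<lparr>carrier := conj_stab G C\<rparr>"
  have "group ?H" using subgroup_imp_group[OF sub] .
  moreover have "finite (carrier ?H)" using finite_carrier by (simp add: conj_stab_def)
  ultimately obtain Y where Y: "subgroup Y ?H" "card Y = p ^ 1"
    using sylow_thm[OF p(1), of ?H 1 k] k by (auto simp: order_def)
  have YG: "subgroup Y G" using incl_subgroup[OF sub Y(1)] .
  interpret Y: subgroup Y G by (rule YG)
  have "Y \<noteq> {\<one>}" using Y(2) prime_gt_1_nat[OF p(1)] by auto
  then obtain y where y: "y \<in> Y" "y \<noteq> \<one>" using Y.one_closed by blast
  have yG: "y \<in> carrier G" using y(1) by simp
  interpret GY: group "G\<lparr>carrier := Y\<rparr>" by (rule subgroup_imp_group[OF YG])
  have "y [^]\<^bsub>G\<lparr>carrier := Y\<rparr>\<^esub> order (G\<lparr>carrier := Y\<rparr>) = \<one>\<^bsub>G\<lparr>carrier := Y\<rparr>\<^esub>"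
    using y(1) by (intro GY.pow_order_eq_1) simp
  then have "y [^] p = \<one>" using Y(2) by (simp add: order_def nat_pow_consistent[symmetric])
  then have "ord y dvd p" using pow_eq_id[OF yG] by simp
  moreover have "ord y \<noteq> 1" using y(2) ord_eq_1[OF yG] by simp
  ultimately have ordy: "ord y = p" using p(1) unfolding prime_nat_iff by blast
  \<comment> \<open>\<open>C\<close> has only one nontrivial element, so whatever normalizes
    \<open>C\<close> centralizes \<open>t\<close>.\<close>
  have "y \<in> conj_stab G C" using subgroup.subset[OF Y(1)] y(1) by auto
  then have "conj_by G y t \<in> C" using \<open>t \<in> C\<close> by (auto simp: conj_stab_def)
  moreover have "conj_by G y t \<noteq> \<one>"
    using conj_by_eq_iff[OF yG t(1) one_closed] t(2) yG by (auto simp: conj_by_def)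
  ultimately have "conj_by G y t = t" using C_eq by auto
  then have comm: "t \<otimes> y = y \<otimes> t" using conj_by_fixed_iff[OF yG t(1)] by simp
  let ?z = "t \<otimes> y"
  have z: "?z \<in> carrier G" using t(1) yG by simp
  have zpow: "?z [^] n = t [^] n \<otimes> y [^] n" for n :: nat
    using pow_mult_distrib[OF comm t(1) yG] .
  have "p dvd ord ?z"
  proof -
    \<comment> \<open>The extra factor 2 in the exponent removes \<open>t\<close>, so that a power
      of \<open>y\<close> alone is left.\<close>
    have "?z [^] (ord ?z * 2) = \<one>" using z by (simp add: nat_pow_pow[symmetric])
    moreover have "t [^] (ord ?z * 2) = \<one>" using t(1,4) by (simp add: pow_eq_id)
    ultimately have "y [^] (ord ?z * 2) = \<one>" using zpow[of "ord ?z * 2"] yG by simp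
    then have "p dvd ord ?z * 2" using pow_eq_id[OF yG] ordy by simp
    moreover have "\<not> p dvd 2" using p primes_dvd_imp_eq two_is_prime_nat by blast
    ultimately show ?thesis using p(1) prime_dvd_mult_iff by blast
  qed
  moreover have "2 dvd ord ?z"
  proof -
    have "?z [^] (ord ?z * p) = \<one>" using z by (simp add: nat_pow_pow[symmetric])
    moreover have "y [^] (ord ?z * p) = \<one>" using yG ordy by (simp add: pow_eq_id)
    ultimately have "t [^] (ord ?z * p) = \<one>" using zpow[of "ord ?z * p"] t(1) by simp
    then have "2 dvd ord ?z * p" using pow_eq_id[OF t(1)] t(4) by simp
    moreover have "\<not> 2 dvd p" using p primes_dvd_imp_eq two_is_prime_nat by blast
    ultimately show ?thesis using two_is_prime_nat prime_dvd_mult_iff by blast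
  qed
  moreover have "coprime 2 p" using p primes_coprime two_is_prime_nat by metis
  ultimately have "2 * p dvd ord ?z" by (simp add: divides_mult)
  moreover have "ord ?z dvd 2 * p" using ord_mul_divides[OF comm t(1) yG] t(4) ordy by simp
  ultimately have ordz: "ord ?z = 2 * p" by (simp add: dvd_antisym)
  then have "?z \<noteq> \<one>" using p(1) by (metis ord_id dvd_triv_left even_numeral odd_one)
  then show ?thesis
    using generate_nontrivial_cyclic[OF z] generate_pow_card[OF z] ordz by (intro bexI[of _ "generate G {?z}"]) auto
qed

text \<open>If the \<open>p\<close>-elements were no more than the elements of one Sylow subgroup, it would be normal.\<close>

lemma sylow_less:
  assumes p: "prime p" "p ^ a dvd order G" and less: "p ^ a < order G" and gt: "1 < p ^ a"
  shows "p ^ a < 1 + (\<Sum>x\<in>#class_data. if fst x dvd p ^ a then snd x * totient (fst x) else 0)"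
proof (rule ccontr)
  let ?T = "{x \<in> carrier G. ord x dvd p ^ a}"
  assume "\<not> ?thesis"
  then have le: "card ?T \<le> p ^ a"
    using card_ord_eq_sum_class_data[of "\<lambda>k. k dvd p ^ a"] by simp
  obtain k where "order G = p ^ a * k" using p(2) by blast
  then obtain P where P: "subgroup P G" "card P = p ^ a"
    using sylow_thm[OF p(1) is_group _ finite_carrier] by blast
  interpret P: subgroup P G by (rule P(1))
  interpret GP: group "G\<lparr>carrier := P\<rparr>" by (rule subgroup_imp_group[OF P(1)])
  have "P \<subseteq> ?T"
  proof
    fix x assume x: "x \<in> P"
    have "x [^]\<^bsub>G\<lparr>carrier := P\<rparr>\<^esub> order (G\<lparr>carrier := P\<rparr>) = \<one>\<^bsub>G\<lparr>carrier := P\<rparr>\<^esub>"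
      using x by (intro GP.pow_order_eq_1) simp
    then have "x [^] (p ^ a) = \<one>" using P(2) by (simp add: order_def nat_pow_consistent[symmetric])
    then show "x \<in> ?T" using pow_eq_id[of x "p ^ a"] x by simp
  qed
  \<comment> \<open>Membership in \<open>?T\<close> depends only on the order of an element, so
    \<open>P\<close> is invariant under conjugation.\<close>
  then have PT: "P = ?T" using le P(2) finite_carrier by (intro card_seteq) auto
  have "x \<otimes> h \<otimes> inv x \<in> P" if x: "x \<in> carrier G" and h: "h \<in> P" for x h
  proof -
    have hG: "h \<in> carrier G" using h by simp
    have "h \<in> ?T" using h by (simp only: PT)
    then have "h [^] (p ^ a) = \<one>" using pow_eq_id[OF hG] by blast
    then have "conj_by G x h [^] (p ^ a) = conj_by G x \<one>"
      using conj_by_pow[OF x hG, of "p ^ a"] by simp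
    also have "\<dots> = \<one>" using x by (simp add: conj_by_def)
    finally have "ord (conj_by G x h) dvd p ^ a"
      using pow_eq_id[OF conj_by_closed[OF x hG]] by blast
    then have "conj_by G x h \<in> ?T" using conj_by_closed[OF x hG] by blast
    then show ?thesis by (simp only: PT conj_by_def)
  qed
  then have "P \<lhd> G" using P(1) by (simp add: normal_inv_iff)
  then consider "P = carrier G" | "P = {\<one>}" using no_real_normal_subgroup by blast
  then show False using P(2) less gt by cases (simp_all add: order_def)
qed

end

section \<open>Reduction to simple groups\<close>

text \<open>Take \<open>K\<close> maximal among the proper normal subgroups. The preimage
  \<open>L'\<close> of a normal subgroup of the quotient is normal and contains \<open>K\<close>, so
  it is \<open>K\<close> or everything.\<close>

lemma (in group) simple_quotientE:
  assumes fin: "finite (carrier G)" and nontriv: "carrier G \<noteq> {\<one>}"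
  obtains K where "K \<lhd> G" "K \<noteq> carrier G" "simple_group (G Mod K)"
proof -
  let ?S = "{K. K \<lhd> G \<and> K \<noteq> carrier G}"
  have sub: "K \<subseteq> carrier G" if "K \<lhd> G" for K
    using that by (simp add: normal_imp_subgroup subgroup.subset)
  then have "?S \<subseteq> Pow (carrier G)" by blast
  then have "finite ?S" using fin finite_subset by blast
  moreover have "?S \<noteq> {}" using one_is_normal nontriv by auto
  ultimately obtain K where K: "K \<lhd> G" "K \<noteq> carrier G"
    and max: "\<And>L. L \<lhd> G \<Longrightarrow> L \<noteq> carrier G \<Longrightarrow> K \<subseteq> L \<Longrightarrow> K = L"
    using finite_has_maximal[of ?S] by blast
  interpret K: normal K G by (rule K(1))
  let ?Q = "G Mod K"
  let ?h = "\<lambda>x. K #> x"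
  interpret Q: group ?Q by (rule K.factorgroup_is_group)
  interpret h: group_hom G ?Q ?h
    by unfold_locales (rule K.r_coset_hom_Mod)
  have carrier_Q: "carrier ?Q = ?h ` carrier G"
    by (auto simp: FactGroup_def RCOSETS_def)
  have "simple_group ?Q"
  proof
    have eq: "order ?Q * card K = order G"
      using lagrange[OF K.subgroup_axioms] by (simp add: order_def FactGroup_def)
    have "order ?Q \<noteq> 1"
    proof
      assume "order ?Q = 1"
      then have "card K = card (carrier G)" using eq by (simp add: order_def)
      then show False using K(2) card_subset_eq[OF fin K.subset] by blast
    qed
    moreover have "order G \<noteq> 0" using fin order_gt_0_iff_finite by simp
    then have "order ?Q \<noteq> 0" using eq by (metis mult_0)
    ultimately show "1 < order ?Q" by linarith
  next
    fix L assume L: "L \<lhd> ?Q"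
    interpret L: normal L ?Q by (rule L)
    define L' where "L' = {x \<in> carrier G. ?h x \<in> L}"
    have "subgroup L' G"
    proof (rule subgroupI)
      show "L' \<noteq> {}" using L.one_closed h.hom_one by (auto simp: L'_def)
      show "inv x \<in> L'" if "x \<in> L'" for x
        using that L.m_inv_closed[of "?h x"] by (auto simp: L'_def)
      show "x \<otimes> y \<in> L'" if "x \<in> L'" "y \<in> L'" for x y
        using that L.m_closed[of "?h x" "?h y"] h.hom_mult[of x y] by (auto simp: L'_def)
    qed (auto simp: L'_def)
    moreover have "x \<otimes> y \<otimes> inv x \<in> L'" if "x \<in> carrier G" "y \<in> L'" for x y
      using that L.inv_op_closed2[of "?h x" "?h y"] h.hom_closed[of x] by (auto simp: L'_def)
    ultimately have L': "L' \<lhd> G" by (simp add: normal_inv_iff)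
    have "K \<subseteq> L'"
    proof
      fix x assume x: "x \<in> K"
      then have "?h x = K" using coset_join2[OF _ K.subgroup_axioms] by simp
      then show "x \<in> L'" using x L.one_closed by (simp add: L'_def FactGroup_def)
    qed
    show "L = carrier ?Q \<or> L = {\<one>\<^bsub>?Q\<^esub>}"
    proof (cases "L' = carrier G")
      case True
      then have "carrier ?Q \<subseteq> L" unfolding carrier_Q by (auto simp: L'_def)
      then show ?thesis using L.subset by blast
    next
      case False
      then have "K = L'" using max L' \<open>K \<subseteq> L'\<close> by blast
      have "q = K" if q: "q \<in> L" for q
      proof -
        have "q \<in> carrier ?Q" using q L.subset by blast
        then obtain x where x: "x \<in> carrier G" "q = ?h x" unfolding carrier_Q by blast
        then have "x \<in> L'" using q by (simp add: L'_def)
        then have "x \<in> K" using \<open>K = L'\<close> by blast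
        then show ?thesis using x coset_join2[OF _ K.subgroup_axioms] by simp
      qed
      then have "L \<subseteq> {K}" by blast
      have one: "\<one>\<^bsub>?Q\<^esub> = K" by (simp add: FactGroup_def)
      have "K \<in> L" using L.one_closed unfolding one .
      then have "L = {K}" using \<open>L \<subseteq> {K}\<close> by (intro subset_antisym) simp_all
      then show ?thesis unfolding one by (rule disjI2)
    qed
  qed
  then show thesis using that K by blast
qed

text \<open>The image of the subgroup generated by \<open>x\<close> is generated by
  \<open>h x\<close>, so a surjection maps cyclic subgroups onto cyclic subgroups.\<close>

lemma (in group_hom) num_cyclic_subgroups_image_le:
  assumes "finite (carrier G)" "h ` carrier G = carrier H"
  shows "num_cyclic_subgroups H \<le> num_cyclic_subgroups G"
proof -
  have "cyclic_subgroups H = (`) h ` cyclic_subgroups G"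
    using assms(2) generate_img[of "{_}"]
    by (simp add: H.cyclic_subgroups_eq_generate G.cyclic_subgroups_eq_generate image_image flip: assms(2))
  then show ?thesis
    using card_image_le[OF G.finite_cyclic_subgroups[OF assms(1)]] by (simp add: num_cyclic_subgroups_def)
qed

lemma (in group) num_cyclic_subgroups_subgroup_le:
  assumes "finite (carrier G)" "subgroup H G"
  shows "num_cyclic_subgroups (G\<lparr>carrier := H\<rparr>) \<le> num_cyclic_subgroups G"
proof -
  have "cyclic_subgroups (G\<lparr>carrier := H\<rparr>) \<subseteq> cyclic_subgroups G"
    using incl_subgroup[OF assms(2)] by (auto simp: cyclic_subgroups_def)
  then show ?thesis
    unfolding num_cyclic_subgroups_def by (rule card_mono[OF finite_cyclic_subgroups[OF assms(1)]])
qed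

text \<open>Take \<open>R\<close> minimal among the non-solvable subgroups. Its derived subgroup is
  not solvable either, so minimality makes the two equal.\<close>

lemma (in group) perfect_subgroupE:
  assumes fin: "finite (carrier G)" and "\<not> solvable G"
  obtains R where "subgroup R G" "R \<noteq> {\<one>}" "derived G R = R"
proof -
  let ?S = "{H. subgroup H G \<and> \<not> solvable_seq G H}"
  have "?S \<subseteq> Pow (carrier G)" using subgroup.subset by blast
  then have "finite ?S" using fin finite_subset by blast
  moreover have "carrier G \<in> ?S" using assms(2) subgroup_self by (simp add: solvable_def)
  then have "?S \<noteq> {}" by blast
  ultimately obtain R where R: "subgroup R G" "\<not> solvable_seq G R"
    and min: "\<And>H. subgroup H G \<Longrightarrow> \<not> solvable_seq G H \<Longrightarrow> H \<subseteq> R \<Longrightarrow> R = H"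
    using finite_has_minimal[of ?S] by blast
  have "subgroup (derived G R) G" by (rule derived_is_subgroup[OF subgroup.subset[OF R(1)]])
  moreover have "\<not> solvable_seq G (derived G R)" using augment_solvable_seq R by blast
  moreover have "derived G R \<subseteq> R" using derived_incl[OF order_refl R(1)] .
  ultimately have "derived G R = R" using min by blast
  moreover have "R \<noteq> {\<one>}" using R(2) solvable_seq.unity by metis
  ultimately show thesis using that R(1) by blast
qed

theorem (in finite_nonabelian_simple_group) num_cyclic_subgroups_gt_31: "31 < num_cyclic_subgroups G"
proof (rule ccontr)
  assume le: "\<not> ?thesis"
  interpret D: cyclic_class_data "order G" class_data
  proof
    show "1 < order G" by (rule order_gt_one)
    show "(\<Sum>x\<in>#class_data. snd x) \<le> 30" using sum_sizes_class_data le by simp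
    show "order G = 1 + (\<Sum>x\<in>#class_data. snd x * totient (fst x))" by (rule order_eq_class_data)
    show "[(\<Sum>x\<in>#class_data. if fst x = p then snd x else 0) = 1] (mod p)"
      if "prime p" "p dvd order G" for p
      using prime_cong_class_data that .
    show "p ^ a < 1 + (\<Sum>x\<in>#class_data. if fst x dvd p ^ a then snd x * totient (fst x) else 0)"
      if "prime p" "p ^ a dvd order G" "p ^ a < order G" "1 < p ^ a" for p a
      using sylow_less that .
  next
    fix m s assume ms: "(m, s) \<in># class_data"
    obtain C where C: "C \<in> nontrivial_cyclic G" "m = card C" "s = card (conj_class G C)"
      using class_dataE[OF ms] .
    have "card C dvd card (conj_stab G C)"
      by (intro subgroup_card_dvd nontrivial_cyclic_subgroup conj_stab_subgroup subgroup_conj_stab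
            finite_carrier C(1))
    then have "card C * card (conj_class G C) dvd card (conj_stab G C) * card (conj_class G C)"
      by (rule mult_dvd_mono) simp
    then show "m * s dvd order G"
      unfolding C(2,3) card_conj_class_mult[OF C(1), symmetric] by (simp only: mult.commute)
    show "order G dvd fact s" unfolding C(3) by (rule order_dvd_fact_card_conj_class[OF C(1)])
    show "2 \<le> m" unfolding C(2) by (rule card_nontrivial_cyclic_ge_2[OF C(1)])
    show "2 \<le> s" unfolding C(3) by (rule card_conj_class_ge_2[OF C(1)])
    show "\<exists>s'. (d, s') \<in># class_data \<and> s' dvd s" if "d dvd m" "2 \<le> d" for d
    proof -
      obtain D where "D \<in> nontrivial_cyclic G" "card D = d" "card (conj_class G D) dvd s"
        using divisor_class[OF C(1), of d] \<open>d dvd m\<close> \<open>2 \<le> d\<close> C(2,3) by blast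
      then show ?thesis using class_dataI by blast
    qed
  next
    fix p s assume p: "prime p" "\<not> p\<^sup>2 dvd order G" "(p, s) \<in># class_data"
    obtain C where "C \<in> nontrivial_cyclic G" "p = card C" "s = card (conj_class G C)"
      using class_dataE[OF p(3)] .
    then show "[s = 1] (mod p)" using sylow_prime_cong[OF p(1,2)] by simp
  next
    fix p s assume p: "(2, s) \<in># class_data" "prime p" "p \<noteq> 2" "p * s dvd order G"
    obtain C where "C \<in> nontrivial_cyclic G" "2 = card C" "s = card (conj_class G C)"
      using class_dataE[OF p(1)] .
    then obtain D where "D \<in> nontrivial_cyclic G" "card D = 2 * p"
      using involution_class[of C p] p(2-4) by auto
    then show "\<exists>s'. (2 * p, s') \<in># class_data" using class_dataI by metis
  qed
  show False by (rule D.contradiction)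
qed

theorem corollary5p5:
  fixes G :: "('a, 'b) monoid_scheme"
  assumes "group G"
    and "finite (carrier G)"
    and "num_cyclic_subgroups G \<le> 31"
  shows "solvable G"
proof (rule ccontr)
  assume "\<not> solvable G"
  interpret group G by (rule assms(1))
  obtain R where R: "subgroup R G" "R \<noteq> {\<one>\<^bsub>G\<^esub>}" "derived G R = R"
    using perfect_subgroupE[OF assms(2) \<open>\<not> solvable G\<close>] .
  let ?R = "G\<lparr>carrier := R\<rparr>"
  interpret R: group ?R by (rule subgroup_imp_group[OF R(1)])
  have fin: "finite (carrier ?R)" using finite_subset[OF subgroup.subset[OF R(1)] assms(2)] by simp
  obtain K where K: "K \<lhd> ?R" "K \<noteq> carrier ?R" "simple_group (?R Mod K)"
    using R.simple_quotientE[OF fin] R(2) by auto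
  interpret K: normal K ?R by (rule K(1))
  interpret Q: simple_group "?R Mod K" by (rule K(3))
  interpret h: group_hom ?R "?R Mod K" "\<lambda>x. K #>\<^bsub>?R\<^esub> x"
    by unfold_locales (rule K.r_coset_hom_Mod)
  have surj: "(\<lambda>x. K #>\<^bsub>?R\<^esub> x) ` carrier ?R = carrier (?R Mod K)"
    by (auto simp: FactGroup_def RCOSETS_def)
  interpret Q: finite_nonabelian_simple_group "?R Mod K"
  proof
    show "finite (carrier (?R Mod K))" using fin unfolding surj[symmetric] by (rule finite_imageI)
    show "\<not> comm_group (?R Mod K)"
    proof
      assume "comm_group (?R Mod K)"
      \<comment> \<open>An abelian quotient would push the derived subgroup, which is all of
        \<open>R\<close>, into the proper subgroup \<open>K\<close>.\<close>
      then have "derived ?R (carrier ?R) \<subseteq> K" by (rule R.derived_minimal[OF K(1)])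
      then have "R \<subseteq> K" using derived_consistent[OF order_refl R(1)] R(3) by simp
      then show False using K(2) K.subset by auto
    qed
  qed
  have "num_cyclic_subgroups (?R Mod K) \<le> num_cyclic_subgroups ?R"
    by (rule h.num_cyclic_subgroups_image_le[OF fin surj])
  also have "\<dots> \<le> num_cyclic_subgroups G"
    by (rule num_cyclic_subgroups_subgroup_le[OF assms(2) R(1)])
  finally show False using Q.num_cyclic_subgroups_gt_31 assms(3) by simp
qed

end
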